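(* Let $\mathbf{A}=(A_s)_{s\in T}$ and $\mathbf{B}=(B_s)_{s\in T}$ be continuous fields of strictly positive operators in $\mathscr A$ such that $0<mA_s\le B_s\le MA_s$ for all $s\in T$, for some positive real numbers $m,M$ with $m<1<M$, and such that $\int_T A_s\,d\mu(s)=\int_T B_s\,d\mu(s)=I_{\mathscr H}$. Let $f:(0,\infty)\to[0,\infty)$ be operator concave and not identically zero, let $p\in[0,1]$ and $t_0\in[m,M]$. Put $$\mu_f=\frac{f(M)-f(m)}{M-m},\qquad \nu_f=\frac{Mf(m)-mf(M)}{M-m},\qquad \gamma_f=\max\left\{\frac{f(t)}{\mu_f t+\nu_f}: m\le t\le M\right\}.$$ Then $$f\left[\int_T (A_s\natural_{p+1}B_s)\,d\mu(s)+t_0\left(I_{\mathscr H}-\int_T A_s\natural_p B_s\,d\mu(s)\right)\right]-\gamma_f f(t_0)\left(I_{\mathscr H}-\int_T A_s\natural_p B_s\,d\mu(s)\right)\ \le\ \gamma_f\,\widetilde S_p^f(\mathbf A|\mathbf B).$$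
   Context: $\mathscr H$ is a complex Hilbert space with identity operator $I_{\mathscr H}$, and $\le$ is the usual (Loewner) order on self-adjoint operators in $\mathbb B(\mathscr H)$. An operator is strictly positive if it is positive and invertible. $\mathscr A$ is a $C^*$-algebra of operators acting on $\mathscr H$, $T$ is a locally compact Hausdorff space and $\mu$ is a Radon measure on $T$. A family $(A_t)_{t\in T}$ in $\mathscr A$ is a continuous field of operators if $t\mapsto A_t$ is norm continuous and $t\mapsto\|A_t\|$ is $\mu$-integrable; its Bochner integral $\int_T A_t\,d\mu(t)$ is the unique element of $\mathscr A$ with $\varphi(\int_T A_t\,d\mu(t))=\int_T\varphi(A_t)\,d\mu(t)$ for all $\varphi\in\mathscr A^*$. A continuous function $f:J\to\mathbb R$ on an interval $J$ is operator concave if $\lambda f(X)+(1-\lambda)f(Y)\le f(\lambda X+(1-\lambda)Y)$ for all $\lambda\in[0,1]$ and all self-adjoint operators $X,Y$ (on any complex Hilbert space) with spectra in $J$. For strictly positive $X,Y$ and $q\in\mathbb R$: $X\natural_q Y=X^{1/2}(X^{-1/2}YX^{-1/2})^qX^{1/2}$ and $S_q^f(X|Y)=X^{1/2}(X^{-1/2}YX^{-1/2})^q f(X^{-1/2}YX^{-1/2})X^{1/2}$. The generalized relative operator entropy is $\widetilde S_q^f(\mathbf A|\mathbf B)=\int_T S_q^f(A_s|B_s)\,d\mu(s)$. (The real number $\mu_f$ is unrelated to the measure $\mu$.) *)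

theory Defs
  imports "HOL-Analysis.Analysis" "HOL-Computational_Algebra.Polynomial"
begin

section \<open>Complex Hilbert spaces\<close>

class scaleC =
  fixes scaleC :: "complex \<Rightarrow> 'a \<Rightarrow> 'a" (infixr \<open>*\<^sub>C\<close> 75)

class complex_inner = real_normed_vector + scaleC +
  fixes cinner :: "'a \<Rightarrow> 'a \<Rightarrow> complex"
  assumes scaleC_add_right: "c *\<^sub>C (x + y) = c *\<^sub>C x + c *\<^sub>C y"
    and scaleC_add_left: "(c + d) *\<^sub>C x = c *\<^sub>C x + d *\<^sub>C x"
    and scaleC_scaleC: "c *\<^sub>C d *\<^sub>C x = (c * d) *\<^sub>C x"
    and scaleR_scaleC: "r *\<^sub>R x = complex_of_real r *\<^sub>C x"
    and cinner_commute: "cinner x y = cnj (cinner y x)"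
    and cinner_add_left: "cinner (x + y) z = cinner x z + cinner y z"
    and cinner_scaleC_left: "cinner (c *\<^sub>C x) y = c * cinner x y"
    and cinner_ge_zero: "0 \<le> Re (cinner x x)"
    and cinner_eq_zero_iff: "cinner x x = 0 \<longleftrightarrow> x = 0"
    and norm_eq_sqrt_cinner: "norm x = sqrt (Re (cinner x x))"

class chilbert_space = complex_inner + banach

lemma norm_scaleC: "norm (c *\<^sub>C x) = cmod c * norm (x :: 'a::complex_inner)"
proof -
  have "cinner (c *\<^sub>C x) (c *\<^sub>C x) = c * cnj (c * cinner x x)"
    by (metis cinner_commute cinner_scaleC_left)
  also have "\<dots> = (c * cnj c) * cinner x x"
    by (metis cinner_commute complex_cnj_mult mult.assoc)
  also have "\<dots> = complex_of_real ((cmod c)\<^sup>2) * cinner x x"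
    by (metis complex_norm_square)
  finally have "Re (cinner (c *\<^sub>C x) (c *\<^sub>C x)) = (cmod c)\<^sup>2 * Re (cinner x x)"
    by simp
  then show ?thesis
    by (simp add: norm_eq_sqrt_cinner real_sqrt_mult)
qed

lemma bounded_linear_scaleC: "bounded_linear (\<lambda>x :: 'a::complex_inner. c *\<^sub>C x)"
proof (rule bounded_linear_intro[where K = "cmod c"])
  show "c *\<^sub>C r *\<^sub>R x = r *\<^sub>R c *\<^sub>C x" for r and x :: 'a
    by (simp add: scaleR_scaleC scaleC_scaleC mult.commute)
qed (simp_all add: scaleC_add_right norm_scaleC)

instantiation blinfun :: (real_normed_vector, complex_inner) scaleC
begin

lift_definition scaleC_blinfun :: "complex \<Rightarrow> ('a \<Rightarrow>\<^sub>L 'b) \<Rightarrow> ('a \<Rightarrow>\<^sub>L 'b)"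
  is "\<lambda>c A x. c *\<^sub>C A x"
  by (rule bounded_linear_compose[OF bounded_linear_scaleC])

instance ..

end


section \<open>Bounded operators\<close>

text \<open>The type \<^typ>\<open>'a \<Rightarrow>\<^sub>L 'a\<close> consists of the bounded \<^emph>\<open>real\<close>-linear operators, so the
  bounded operators of the complex space are singled out by a carrier set.\<close>

definition bounded_ops :: "('a::complex_inner \<Rightarrow>\<^sub>L 'a) set" where
  "bounded_ops = {A :: 'a \<Rightarrow>\<^sub>L 'a. \<forall>c x. A (c *\<^sub>C x) = c *\<^sub>C A x}"

definition is_adjoint :: "('a::complex_inner \<Rightarrow>\<^sub>L 'a) \<Rightarrow> ('a \<Rightarrow>\<^sub>L 'a) \<Rightarrow> bool" where
  "is_adjoint A B \<longleftrightarrow> (\<forall>x y. cinner (A x) y = cinner x (B y))"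

definition self_adjoint :: "('a::complex_inner \<Rightarrow>\<^sub>L 'a) \<Rightarrow> bool" where
  "self_adjoint A \<longleftrightarrow> A \<in> bounded_ops \<and> is_adjoint A A"

definition loewner_le :: "('a::complex_inner \<Rightarrow>\<^sub>L 'a) \<Rightarrow> ('a \<Rightarrow>\<^sub>L 'a) \<Rightarrow> bool" (infix \<open>\<preceq>\<close> 50) where
  "A \<preceq> B \<longleftrightarrow> self_adjoint A \<and> self_adjoint B \<and>
     (\<forall>x. Re (cinner (A x) x) \<le> Re (cinner (B x) x))"

definition strictly_positive :: "('a::complex_inner \<Rightarrow>\<^sub>L 'a) \<Rightarrow> bool" where
  "strictly_positive A \<longleftrightarrow> 0 \<preceq> A \<and>
     (\<exists>B\<in>bounded_ops. A o\<^sub>L B = id_blinfun \<and> B o\<^sub>L A = id_blinfun)"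

definition cstar_algebra :: "('a::complex_inner \<Rightarrow>\<^sub>L 'a) set \<Rightarrow> bool" where
  "cstar_algebra \<A> \<longleftrightarrow> \<A> \<subseteq> bounded_ops \<and> 0 \<in> \<A> \<and>
     (\<forall>A\<in>\<A>. \<forall>B\<in>\<A>. A + B \<in> \<A>) \<and> (\<forall>c. \<forall>A\<in>\<A>. c *\<^sub>C A \<in> \<A>) \<and>
     (\<forall>A\<in>\<A>. \<forall>B\<in>\<A>. A o\<^sub>L B \<in> \<A>) \<and> (\<forall>A\<in>\<A>. \<exists>B\<in>\<A>. is_adjoint A B) \<and> closed \<A>"


section \<open>Spectrum and continuous functional calculus\<close>

text \<open>The operators on a closed subspace \<open>K\<close> with orthogonal projection \<open>E\<close> are identified with
  the operators \<open>A\<close> on the whole space such that \<open>E A E = A\<close>; the identity of \<open>K\<close> is then \<open>E\<close>.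
  Spectrum and functional calculus take \<open>E\<close> as a parameter, so that they can be used on all closed
  subspaces of a given Hilbert space; \<open>E = id_blinfun\<close> gives the usual notions on the whole space.\<close>

definition orth_projection :: "('a::complex_inner \<Rightarrow>\<^sub>L 'a) \<Rightarrow> bool" where
  "orth_projection E \<longleftrightarrow> self_adjoint E \<and> E o\<^sub>L E = E"

definition ops_on :: "('a::complex_inner \<Rightarrow>\<^sub>L 'a) \<Rightarrow> ('a \<Rightarrow>\<^sub>L 'a) set" where
  "ops_on E = {A \<in> bounded_ops. E o\<^sub>L A o\<^sub>L E = A}"

definition op_spectrum :: "('a::complex_inner \<Rightarrow>\<^sub>L 'a) \<Rightarrow> ('a \<Rightarrow>\<^sub>L 'a) \<Rightarrow> complex set" where
  "op_spectrum E A =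
     {z. \<not> (\<exists>B\<in>ops_on E. (A - z *\<^sub>C E) o\<^sub>L B = E \<and> B o\<^sub>L (A - z *\<^sub>C E) = E)}"

definition op_poly :: "('a::complex_inner \<Rightarrow>\<^sub>L 'a) \<Rightarrow> real poly \<Rightarrow> ('a \<Rightarrow>\<^sub>L 'a) \<Rightarrow> ('a \<Rightarrow>\<^sub>L 'a)" where
  "op_poly E p A = (\<Sum>k\<le>degree p. coeff p k *\<^sub>R (((\<lambda>B. A o\<^sub>L B) ^^ k) E))"

text \<open>For self-adjoint \<open>A\<close> and \<open>f\<close> continuous on the spectrum of \<open>A\<close>, \<open>f(A)\<close> is the norm limit of
  \<open>p\<^sub>n(A)\<close> for real polynomials \<open>p\<^sub>n\<close> converging to \<open>f\<close> uniformly on the spectrum.\<close>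

definition fun_calc_on ::
    "('a::complex_inner \<Rightarrow>\<^sub>L 'a) \<Rightarrow> (real \<Rightarrow> real) \<Rightarrow> ('a \<Rightarrow>\<^sub>L 'a) \<Rightarrow> ('a \<Rightarrow>\<^sub>L 'a)" where
  "fun_calc_on E f A = (THE Y. \<exists>p :: nat \<Rightarrow> real poly.
     uniform_limit {t. complex_of_real t \<in> op_spectrum E A} (\<lambda>n. poly (p n)) f sequentially \<and>
     (\<lambda>n. op_poly E (p n) A) \<longlonglongrightarrow> Y)"

abbreviation fun_calc :: "(real \<Rightarrow> real) \<Rightarrow> ('a::complex_inner \<Rightarrow>\<^sub>L 'a) \<Rightarrow> ('a \<Rightarrow>\<^sub>L 'a)" where
  "fun_calc f A \<equiv> fun_calc_on id_blinfun f A"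

definition op_powr :: "('a::complex_inner \<Rightarrow>\<^sub>L 'a) \<Rightarrow> real \<Rightarrow> ('a \<Rightarrow>\<^sub>L 'a)" where
  "op_powr A q = fun_calc (\<lambda>t. t powr q) A"


section \<open>The Hilbert space of square-summable families\<close>

typedef 'i ell2 = "{x :: 'i \<Rightarrow> complex. (\<lambda>i. (cmod (x i))\<^sup>2) summable_on UNIV}"
  morphisms ell2_apply Abs_ell2
  by (rule exI[of _ "\<lambda>_. 0"]) simp

setup_lifting type_definition_ell2

lemma ell2_sum_le:
  assumes "(\<lambda>i. (cmod (x i))\<^sup>2) summable_on UNIV" and "finite F"
  shows "L2_set (\<lambda>i. cmod (x i)) F \<le> sqrt (\<Sum>\<^sub>\<infinity>i. (cmod (x i))\<^sup>2)"
  unfolding L2_set_def using assms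
  by (intro real_sqrt_le_mono finite_sum_le_infsum) auto

lemma ell2I:
  assumes "\<And>F. finite F \<Longrightarrow> L2_set (\<lambda>i. cmod (x i)) F \<le> C"
  shows "(\<lambda>i. (cmod (x i))\<^sup>2) summable_on UNIV" "sqrt (\<Sum>\<^sub>\<infinity>i. (cmod (x i))\<^sup>2) \<le> C"
proof -
  have C: "0 \<le> C" using assms[of "{}"] by simp
  have b: "(\<Sum>i\<in>F. (cmod (x i))\<^sup>2) \<le> C\<^sup>2" if "finite F" for F
    using assms[OF that] C unfolding L2_set_def by (metis real_sqrt_le_iff real_sqrt_unique)
  show s: "(\<lambda>i. (cmod (x i))\<^sup>2) summable_on UNIV"
    by (rule nonneg_bdd_above_summable_on) (auto intro!: bdd_aboveI2[where M = "C\<^sup>2"] b)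
  have "(\<Sum>\<^sub>\<infinity>i. (cmod (x i))\<^sup>2) \<le> C\<^sup>2"
    using infsum_le_finite_sums[OF s] b by blast
  then show "sqrt (\<Sum>\<^sub>\<infinity>i. (cmod (x i))\<^sup>2) \<le> C"
    using C real_le_lsqrt by (simp add: infsum_nonneg)
qed

lemma ell2_triangle_aux:
  assumes x: "(\<lambda>i. (cmod (x i))\<^sup>2) summable_on UNIV" and y: "(\<lambda>i. (cmod (y i))\<^sup>2) summable_on UNIV"
    and "finite F"
  shows "L2_set (\<lambda>i. cmod (x i + y i)) F
    \<le> sqrt (\<Sum>\<^sub>\<infinity>i. (cmod (x i))\<^sup>2) + sqrt (\<Sum>\<^sub>\<infinity>i. (cmod (y i))\<^sup>2)"
proof -
  have "L2_set (\<lambda>i. cmod (x i + y i)) F \<le> L2_set (\<lambda>i. cmod (x i) + cmod (y i)) F"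
    by (rule L2_set_mono) (auto simp: norm_triangle_ineq)
  also have "\<dots> \<le> L2_set (\<lambda>i. cmod (x i)) F + L2_set (\<lambda>i. cmod (y i)) F"
    by (rule L2_set_triangle_ineq)
  also have "\<dots> \<le> sqrt (\<Sum>\<^sub>\<infinity>i. (cmod (x i))\<^sup>2) + sqrt (\<Sum>\<^sub>\<infinity>i. (cmod (y i))\<^sup>2)"
    using ell2_sum_le[OF x \<open>finite F\<close>] ell2_sum_le[OF y \<open>finite F\<close>] by linarith
  finally show ?thesis .
qed

lemma ell2_scale_aux:
  assumes "(\<lambda>i. (cmod (x i))\<^sup>2) summable_on UNIV"
  shows "(\<lambda>i. (cmod (c * x i))\<^sup>2) summable_on UNIV"
  using summable_on_cmult_right[OF assms, of "(cmod c)\<^sup>2"]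
  by (simp add: norm_mult power_mult_distrib)

lemma ell2_prod_summable:
  assumes x: "(\<lambda>i. (cmod (x i))\<^sup>2) summable_on UNIV" and y: "(\<lambda>i. (cmod (y i))\<^sup>2) summable_on UNIV"
  shows "(\<lambda>i. x i * cnj (y i)) summable_on UNIV"
proof (rule abs_summable_summable, rule summable_on_comparison_test[OF summable_on_add[OF x y]])
  show "norm (x i * cnj (y i)) \<le> (cmod (x i))\<^sup>2 + (cmod (y i))\<^sup>2" for i
    using sum_squares_bound[of "cmod (x i)" "cmod (y i)"]
      mult_nonneg_nonneg[OF norm_ge_zero[of "x i"] norm_ge_zero[of "y i"]]
    by (simp add: norm_mult del: mult_nonneg_nonneg zero_le_mult_iff)
qed simp

instantiation ell2 :: (type) real_normed_vector
begin

lift_definition zero_ell2 :: "'a ell2" is "\<lambda>_. 0" by simp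
lift_definition plus_ell2 :: "'a ell2 \<Rightarrow> 'a ell2 \<Rightarrow> 'a ell2" is "\<lambda>x y i. x i + y i"
  by (rule ell2I(1), rule ell2_triangle_aux)
lift_definition uminus_ell2 :: "'a ell2 \<Rightarrow> 'a ell2" is "\<lambda>x i. - x i" by simp
lift_definition scaleR_ell2 :: "real \<Rightarrow> 'a ell2 \<Rightarrow> 'a ell2" is "\<lambda>r x i. complex_of_real r * x i"
  by (rule ell2_scale_aux)
lift_definition norm_ell2 :: "'a ell2 \<Rightarrow> real" is "\<lambda>x. sqrt (\<Sum>\<^sub>\<infinity>i. (cmod (x i))\<^sup>2)" .

definition minus_ell2 :: "'a ell2 \<Rightarrow> 'a ell2 \<Rightarrow> 'a ell2" where "minus_ell2 x y = x + (- y)"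
definition sgn_ell2 :: "'a ell2 \<Rightarrow> 'a ell2" where "sgn_ell2 x = scaleR (inverse (norm x)) x"
definition dist_ell2 :: "'a ell2 \<Rightarrow> 'a ell2 \<Rightarrow> real" where "dist_ell2 x y = norm (x - y)"
definition [code del]:
  "(uniformity :: ('a ell2 \<times> 'a ell2) filter) = (INF e\<in>{0 <..}. principal {(x, y). dist x y < e})"
definition open_ell2 :: "'a ell2 set \<Rightarrow> bool" where [code del]:
  "open_ell2 S = (\<forall>x\<in>S. \<forall>\<^sub>F (x', y) in uniformity. x' = x \<longrightarrow> y \<in> S)"

instance
proof
  fix x y z :: "'a ell2" and a b :: real
  show "x + y + z = x + (y + z)" by transfer (simp add: add.assoc)
  show "x + y = y + x" by transfer (simp add: add.commute)
  show "0 + x = x" by transfer simp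
  show "- x + x = 0" by transfer simp
  show "x - y = x + - y" by (rule minus_ell2_def)
  show "a *\<^sub>R (x + y) = a *\<^sub>R x + a *\<^sub>R y" by transfer (simp add: distrib_left)
  show "(a + b) *\<^sub>R x = a *\<^sub>R x + b *\<^sub>R x" by transfer (simp add: distrib_right)
  show "a *\<^sub>R b *\<^sub>R x = (a * b) *\<^sub>R x" by transfer (simp add: mult.assoc)
  show "1 *\<^sub>R x = x" by transfer simp
  show "sgn x = inverse (norm x) *\<^sub>R x" by (simp add: sgn_ell2_def)
  show "dist x y = norm (x - y)" by (rule dist_ell2_def)
  show "(uniformity :: ('a ell2 \<times> 'a ell2) filter)
      = (INF e\<in>{0 <..}. principal {(x, y). dist x y < e})"
    by (rule uniformity_ell2_def)
  show "open U = (\<forall>x\<in>U. \<forall>\<^sub>F (x', y) in uniformity. x' = x \<longrightarrow> y \<in> U)" for U :: "'a ell2 set"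
    by (rule open_ell2_def)
  show "norm x = 0 \<longleftrightarrow> x = 0"
  proof transfer
    fix x :: "'a \<Rightarrow> complex"
    assume s: "(\<lambda>i. (cmod (x i))\<^sup>2) summable_on UNIV"
    have "x = (\<lambda>_. 0)" if "(\<Sum>\<^sub>\<infinity>i. (cmod (x i))\<^sup>2) = 0"
    proof
      fix i
      have "(cmod (x i))\<^sup>2 = 0"
        by (rule nonneg_infsum_le_0D[where A = UNIV]) (use s that in simp_all)
      then show "x i = 0" by simp
    qed
    then show "sqrt (\<Sum>\<^sub>\<infinity>i. (cmod (x i))\<^sup>2) = 0 \<longleftrightarrow> x = (\<lambda>_. 0)"
      by (metis (no_types, lifting) infsum_0 norm_zero power_zero_numeral real_sqrt_eq_0_iff)
  qed
  show "norm (x + y) \<le> norm x + norm y"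
    by transfer (rule ell2I(2), rule ell2_triangle_aux)
  show "norm (a *\<^sub>R x) = \<bar>a\<bar> * norm x"
    proof transfer
    fix a :: real and x :: "'a \<Rightarrow> complex"
    have "(\<Sum>\<^sub>\<infinity>i. (cmod (complex_of_real a * x i))\<^sup>2) = (\<Sum>\<^sub>\<infinity>i. a\<^sup>2 * (cmod (x i))\<^sup>2)"
      by (simp only: norm_mult power_mult_distrib norm_of_real power2_abs)
    also have "\<dots> = a\<^sup>2 * (\<Sum>\<^sub>\<infinity>i. (cmod (x i))\<^sup>2)"
      by (rule infsum_cmult_right')
    finally show "sqrt (\<Sum>\<^sub>\<infinity>i. (cmod (complex_of_real a * x i))\<^sup>2)
        = \<bar>a\<bar> * sqrt (\<Sum>\<^sub>\<infinity>i. (cmod (x i))\<^sup>2)"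
      by (simp only: real_sqrt_mult real_sqrt_abs)
  qed
qed

end

instantiation ell2 :: (type) chilbert_space
begin

lift_definition scaleC_ell2 :: "complex \<Rightarrow> 'a ell2 \<Rightarrow> 'a ell2" is "\<lambda>c x i. c * x i"
  by (rule ell2_scale_aux)
lift_definition cinner_ell2 :: "'a ell2 \<Rightarrow> 'a ell2 \<Rightarrow> complex"
  is "\<lambda>x y. \<Sum>\<^sub>\<infinity>i. x i * cnj (y i)" .

lemma ell2_cinner_self: "cinner x x = complex_of_real ((norm (x :: 'a ell2))\<^sup>2)"
proof transfer
  fix x :: "'a \<Rightarrow> complex"
  assume s: "(\<lambda>i. (cmod (x i))\<^sup>2) summable_on UNIV"
  have "(\<Sum>\<^sub>\<infinity>i. x i * cnj (x i)) = (\<Sum>\<^sub>\<infinity>i. complex_of_real ((cmod (x i))\<^sup>2))"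
    by (simp only: complex_norm_square)
  also have "\<dots> = complex_of_real (\<Sum>\<^sub>\<infinity>i. (cmod (x i))\<^sup>2)"
    by (rule infsumI[OF has_sum_of_real[OF has_sum_infsum[OF s]]])
  finally show "(\<Sum>\<^sub>\<infinity>i. x i * cnj (x i))
      = complex_of_real ((sqrt (\<Sum>\<^sub>\<infinity>i. (cmod (x i))\<^sup>2))\<^sup>2)"
    by (simp add: infsum_nonneg)
qed

lemma ell2_Cauchy_convergent:
  fixes X :: "nat \<Rightarrow> 'a ell2"
  assumes "Cauchy X"
  shows "convergent X"
proof -
  have diff: "ell2_apply (x - y) i = ell2_apply x i - ell2_apply y i" for x y :: "'a ell2" and i
    unfolding minus_ell2_def plus_ell2.rep_eq uminus_ell2.rep_eq by simp
  have L2: "L2_set (\<lambda>i. cmod (ell2_apply x i)) F \<le> norm x" if "finite F" for x :: "'a ell2" and F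
    using that by transfer (rule ell2_sum_le)
  have coord: "cmod (ell2_apply x i) \<le> norm x" for x :: "'a ell2" and i
    using L2[of "{i}" x] by (simp add: L2_set_def)
  have "convergent (\<lambda>n. ell2_apply (X n) i)" for i
  proof (rule Cauchy_convergent, rule metric_CauchyI)
    fix e :: real assume "0 < e"
    then obtain N where N: "\<forall>m\<ge>N. \<forall>n\<ge>N. dist (X m) (X n) < e"
      using metric_CauchyD[OF assms] by blast
    have "dist (ell2_apply (X m) i) (ell2_apply (X n) i) \<le> dist (X m) (X n)" for m n
      using coord[of "X m - X n" i] by (simp only: dist_norm diff)
    then have "\<forall>m\<ge>N. \<forall>n\<ge>N. dist (ell2_apply (X m) i) (ell2_apply (X n) i) < e"
      using N by (intro allI impI) (rule le_less_trans, assumption, simp)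
    then show "\<exists>N. \<forall>m\<ge>N. \<forall>n\<ge>N. dist (ell2_apply (X m) i) (ell2_apply (X n) i) < e" ..
  qed
  then have "(\<lambda>n. ell2_apply (X n) i) \<longlonglongrightarrow> lim (\<lambda>n. ell2_apply (X n) i)" for i
    by (simp only: convergent_LIMSEQ_iff)
  then obtain l where l: "\<And>i. (\<lambda>n. ell2_apply (X n) i) \<longlonglongrightarrow> l i"
    by (rule that[of "\<lambda>i. lim (\<lambda>n. ell2_apply (X n) i)"])
  have near: "\<exists>N. \<forall>n\<ge>N. \<forall>F. finite F \<longrightarrow> L2_set (\<lambda>i. cmod (ell2_apply (X n) i - l i)) F \<le> e"
    if "0 < e" for e
  proof -
    obtain N where N: "\<forall>m\<ge>N. \<forall>n\<ge>N. dist (X m) (X n) < e"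
      using metric_CauchyD[OF assms \<open>0 < e\<close>] by blast
    have "L2_set (\<lambda>i. cmod (ell2_apply (X n) i - l i)) F \<le> e" if "n \<ge> N" "finite F" for n F
    proof (rule LIMSEQ_le_const2)
      show "(\<lambda>m. L2_set (\<lambda>i. cmod (ell2_apply (X n) i - ell2_apply (X m) i)) F)
          \<longlonglongrightarrow> L2_set (\<lambda>i. cmod (ell2_apply (X n) i - l i)) F"
        unfolding L2_set_def
        by (intro tendsto_real_sqrt tendsto_sum tendsto_power tendsto_norm tendsto_diff tendsto_const l)
      have "L2_set (\<lambda>i. cmod (ell2_apply (X n) i - ell2_apply (X m) i)) F \<le> e" if "m \<ge> N" for m
      proof -
        have "norm (X n - X m) < e"
          using N \<open>n \<ge> N\<close> that by (simp add: dist_norm)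
        with L2[OF \<open>finite F\<close>, of "X n - X m"] show ?thesis
          unfolding diff by linarith
      qed
      then show "\<exists>N. \<forall>m\<ge>N. L2_set (\<lambda>i. cmod (ell2_apply (X n) i - ell2_apply (X m) i)) F \<le> e"
        by blast
    qed
    then show ?thesis by blast
  qed
  obtain N1 where N1: "\<And>F. finite F \<Longrightarrow> L2_set (\<lambda>i. cmod (ell2_apply (X N1) i - l i)) F \<le> 1"
    using near[of 1] by auto
  have s1: "(\<lambda>i. (cmod (ell2_apply (X N1) i - l i))\<^sup>2) summable_on UNIV"
    by (rule ell2I(1)[OF N1])
  have s2: "(\<lambda>i. (cmod (- ell2_apply (X N1) i))\<^sup>2) summable_on UNIV"
    using ell2_apply[of "X N1"] by simp
  have "(\<lambda>i. (cmod (ell2_apply (X N1) i - l i + - ell2_apply (X N1) i))\<^sup>2) summable_on UNIV"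
    by (rule ell2I(1), rule ell2_triangle_aux[OF s1 s2])
  then have "l \<in> {x. (\<lambda>i. (cmod (x i))\<^sup>2) summable_on UNIV}"
    by simp
  then have L: "ell2_apply (Abs_ell2 l) = l"
    by (rule Abs_ell2_inverse)
  have "X \<longlonglongrightarrow> Abs_ell2 l"
  proof (rule metric_LIMSEQ_I)
    fix e :: real assume "0 < e"
    then obtain N where N: "\<And>n F. n \<ge> N \<Longrightarrow> finite F \<Longrightarrow>
        L2_set (\<lambda>i. cmod (ell2_apply (X n) i - l i)) F \<le> e / 2"
      using near[of "e / 2"] by auto
    have "norm (X n - Abs_ell2 l) \<le> e / 2" if "n \<ge> N" for n
      unfolding norm_ell2.rep_eq diff L by (rule ell2I(2), rule N[OF that])
    then show "\<exists>N. \<forall>n\<ge>N. dist (X n) (Abs_ell2 l) < e"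
      using \<open>0 < e\<close> unfolding dist_norm
      by (intro exI[of _ N] allI impI) (rule le_less_trans[where y = "e / 2"], simp_all)
  qed
  then show ?thesis by (rule convergentI)
qed

instance
proof
  fix x y z :: "'a ell2" and c d :: complex and r :: real
  show "c *\<^sub>C (x + y) = c *\<^sub>C x + c *\<^sub>C y" by transfer (simp add: distrib_left)
  show "(c + d) *\<^sub>C x = c *\<^sub>C x + d *\<^sub>C x" by transfer (simp add: distrib_right)
  show "c *\<^sub>C d *\<^sub>C x = (c * d) *\<^sub>C x" by transfer (simp add: mult.assoc)
  show "r *\<^sub>R x = complex_of_real r *\<^sub>C x" by transfer simp
  show "cinner x y = cnj (cinner y x)"
    by transfer (simp only: infsum_cnj[symmetric] complex_cnj_mult complex_cnj_cnj mult.commute)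
  show "cinner (x + y) z = cinner x z + cinner y z"
    by transfer (simp add: distrib_right infsum_add ell2_prod_summable)
  show "cinner (c *\<^sub>C x) y = c * cinner x y"
    by transfer (simp only: mult.assoc infsum_cmult_right')
  show "0 \<le> Re (cinner x x)" by (simp add: ell2_cinner_self)
  show "cinner x x = 0 \<longleftrightarrow> x = 0" by (simp add: ell2_cinner_self)
  show "norm x = sqrt (Re (cinner x x))" by (simp add: ell2_cinner_self)
  show "Cauchy X \<Longrightarrow> convergent X" for X :: "nat \<Rightarrow> 'a ell2" by (rule ell2_Cauchy_convergent)
qed

end


section \<open>Operator concave functions\<close>

text \<open>HOL cannot quantify over types inside a formula, so ``every complex Hilbert space'' is rendered
  as ``every closed subspace of \<^typ>\<open>'i ell2\<close>'': up to unitary equivalence these are exactly the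
  complex Hilbert spaces of Hilbert dimension at most the cardinality of \<^typ>\<open>'i\<close>.
  With \<^typ>\<open>'a \<times> nat\<close> for \<^typ>\<open>'i\<close>, where \<^typ>\<open>'a\<close> is itself a Hilbert space, these include
  \<^typ>\<open>'a\<close>, its countable direct sums, and all finite-dimensional and separable Hilbert spaces.\<close>

definition operator_concave :: "'i itself \<Rightarrow> real set \<Rightarrow> (real \<Rightarrow> real) \<Rightarrow> bool" where
  "operator_concave _ J f \<longleftrightarrow> continuous_on J f \<and>
     (\<forall>E :: 'i ell2 \<Rightarrow>\<^sub>L 'i ell2. orth_projection E \<longrightarrow>
       (\<forall>X\<in>ops_on E. \<forall>Y\<in>ops_on E. self_adjoint X \<longrightarrow> self_adjoint Y \<longrightarrow>
         op_spectrum E X \<subseteq> complex_of_real ` J \<longrightarrow> op_spectrum E Y \<subseteq> complex_of_real ` J \<longrightarrow>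
         (\<forall>l\<in>{0..1}. l *\<^sub>R fun_calc_on E f X + (1 - l) *\<^sub>R fun_calc_on E f Y
            \<preceq> fun_calc_on E f (l *\<^sub>R X + (1 - l) *\<^sub>R Y))))"


section \<open>Continuous fields of operators and their integrals\<close>

text \<open>Borel measure, finite on compact sets, outer regular on Borel sets, and inner regular by
  compact sets on open sets.\<close>

definition radon_measure :: "'t::t2_space measure \<Rightarrow> bool" where
  "radon_measure \<mu> \<longleftrightarrow> sets \<mu> = sets borel \<and>
     (\<forall>K. compact K \<longrightarrow> emeasure \<mu> K < \<infinity>) \<and>
     (\<forall>S\<in>sets borel. emeasure \<mu> S = (INF U\<in>{U. open U \<and> S \<subseteq> U}. emeasure \<mu> U)) \<and>
     (\<forall>U. open U \<longrightarrow> emeasure \<mu> U = (SUP K\<in>{K. compact K \<and> K \<subseteq> U}. emeasure \<mu> K))"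

definition continuous_field ::
    "('a::complex_inner \<Rightarrow>\<^sub>L 'a) set \<Rightarrow> 't::t2_space measure \<Rightarrow> ('t \<Rightarrow> 'a \<Rightarrow>\<^sub>L 'a) \<Rightarrow> bool" where
  "continuous_field \<A> \<mu> A \<longleftrightarrow>
     (\<forall>t. A t \<in> \<A>) \<and> continuous_on UNIV A \<and> integrable \<mu> (\<lambda>t. norm (A t))"

text \<open>Bounded complex-linear functionals on \<open>\<A>\<close>; only their values on \<open>\<A>\<close> matter.\<close>

definition dual_space :: "('a::complex_inner \<Rightarrow>\<^sub>L 'a) set \<Rightarrow> (('a \<Rightarrow>\<^sub>L 'a) \<Rightarrow> complex) set" where
  "dual_space \<A> = {\<phi>. (\<forall>A\<in>\<A>. \<forall>B\<in>\<A>. \<phi> (A + B) = \<phi> A + \<phi> B) \<and>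
     (\<forall>c. \<forall>A\<in>\<A>. \<phi> (c *\<^sub>C A) = c * \<phi> A) \<and> (\<exists>C. \<forall>A\<in>\<A>. cmod (\<phi> A) \<le> C * norm A)}"

text \<open>The Bochner integral of the library is restricted to second countable target spaces, which
  excludes spaces of operators; the integral is therefore defined through the dual space.\<close>

definition op_integral ::
    "('a::complex_inner \<Rightarrow>\<^sub>L 'a) set \<Rightarrow> 't::t2_space measure \<Rightarrow> ('t \<Rightarrow> 'a \<Rightarrow>\<^sub>L 'a) \<Rightarrow> ('a \<Rightarrow>\<^sub>L 'a)" where
  "op_integral \<A> \<mu> A = (THE Z. Z \<in> \<A> \<and> (\<forall>\<phi>\<in>dual_space \<A>. \<phi> Z = (\<integral>t. \<phi> (A t) \<partial>\<mu>)))"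


section \<open>Relative operator entropy\<close>

definition natural_mean :: "real \<Rightarrow> ('a::complex_inner \<Rightarrow>\<^sub>L 'a) \<Rightarrow> ('a \<Rightarrow>\<^sub>L 'a) \<Rightarrow> ('a \<Rightarrow>\<^sub>L 'a)" where
  "natural_mean q X Y =
     op_powr X (1/2) o\<^sub>L op_powr (op_powr X (-1/2) o\<^sub>L Y o\<^sub>L op_powr X (-1/2)) q o\<^sub>L op_powr X (1/2)"

definition rel_entropy ::
    "real \<Rightarrow> (real \<Rightarrow> real) \<Rightarrow> ('a::complex_inner \<Rightarrow>\<^sub>L 'a) \<Rightarrow> ('a \<Rightarrow>\<^sub>L 'a) \<Rightarrow> ('a \<Rightarrow>\<^sub>L 'a)" where
  "rel_entropy q f X Y =
     (let C = op_powr X (-1/2) o\<^sub>L Y o\<^sub>L op_powr X (-1/2)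
      in op_powr X (1/2) o\<^sub>L op_powr C q o\<^sub>L fun_calc f C o\<^sub>L op_powr X (1/2))"

definition gen_rel_entropy ::
    "('a::complex_inner \<Rightarrow>\<^sub>L 'a) set \<Rightarrow> 't::t2_space measure \<Rightarrow> real \<Rightarrow> (real \<Rightarrow> real) \<Rightarrow>
     ('t \<Rightarrow> 'a \<Rightarrow>\<^sub>L 'a) \<Rightarrow> ('t \<Rightarrow> 'a \<Rightarrow>\<^sub>L 'a) \<Rightarrow> ('a \<Rightarrow>\<^sub>L 'a)" where
  "gen_rel_entropy \<A> \<mu> q f A B = op_integral \<A> \<mu> (\<lambda>s. rel_entropy q f (A s) (B s))"

definition chord_slope :: "(real \<Rightarrow> real) \<Rightarrow> real \<Rightarrow> real \<Rightarrow> real" where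
  "chord_slope f m M = (f M - f m) / (M - m)"

definition chord_intercept :: "(real \<Rightarrow> real) \<Rightarrow> real \<Rightarrow> real \<Rightarrow> real" where
  "chord_intercept f m M = (M * f m - m * f M) / (M - m)"

text \<open>\<^const>\<open>Greatest\<close> is the maximum; \<^const>\<open>Max\<close> would require a finite set.\<close>

definition chord_ratio_max :: "(real \<Rightarrow> real) \<Rightarrow> real \<Rightarrow> real \<Rightarrow> real" where
  "chord_ratio_max f m M =
     (GREATEST r. r \<in> (\<lambda>t. f t / (chord_slope f m M * t + chord_intercept f m M)) ` {m..M})"

end

theory Submission
  imports Defs "HOL-Computational_Algebra.Fundamental_Theorem_Algebra"
begin

text \<open>Write \<open>C s\<close> for the quotient \<open>A s powr (-1/2) o\<^sub>L B s o\<^sub>L A s powr (-1/2)\<close>, which lies between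
  \<open>m\<close> and \<open>M\<close>.  The map that sends a continuous function \<open>g\<close> on \<open>{m..M}\<close> to the integral \<open>J g\<close> of
  \<open>A s powr (1/2) o\<^sub>L g(C s) o\<^sub>L A s powr (1/2)\<close> is linear and monotone
  (\<open>quad_integral_perspective_linear\<close>, \<open>quad_integral_perspective_mono\<close>) and sends the functions 1 and
  \<open>t\<close> to the integrals of \<open>A\<close> and \<open>B\<close>, that is, to the identity \<open>I\<close>.  With \<open>P\<close>, \<open>Q\<close> and \<open>S\<close> for the
  images of \<open>t powr p\<close>, \<open>t powr (p + 1)\<close> and \<open>t powr p * f t\<close>, the theorem is about
  \<open>Z = Q + t0 * (I - P)\<close> and the entropy \<open>S\<close>.

  From \<open>t powr p \<le> p * t + (1 - p)\<close> one gets \<open>P \<le> I\<close>, and with \<open>m * P \<le> Q \<le> M * P\<close> this gives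
  \<open>m * I \<le> Z \<le> M * I\<close>.  Let \<open>L\<close> be the chord of \<open>f\<close> over \<open>{m..M}\<close>.  As \<open>f\<close> is concave and positive,
  \<open>0 < L \<le> f \<le> \<gamma> * L\<close> there (\<open>chord_between\<close>, \<open>chord_ratio_max_bound\<close>).  Since \<open>L\<close> is affine,
  \<open>L(Z)\<close> is the sum of the image of \<open>t powr p * L t\<close> and of \<open>L(t0) * (I - P)\<close>; hence
  \<open>f(Z) \<le> \<gamma> * L(Z) \<le> \<gamma> * (S + f(t0) * (I - P))\<close>, as claimed.  Concavity
  of the scalar function \<open>f\<close> is operator concavity at multiples of the identity
  (\<open>concave_on_if_operator_concave\<close>).

  The remaining work is to found the two constructions.  For the functional calculus, the main point is
  that a real polynomial bounded below by \<open>c\<close> on the spectrum of a self-adjoint operator is bounded below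
  by \<open>c\<close> at the operator (\<open>quad_op_poly_ge\<close>); with the Weierstrass theorem this gives a monotone
  multiplicative calculus that depends continuously on the operator.  For the integral, the main point is
  existence (\<open>ex_op_integral\<close>): a continuous field is approximated by step functions on compact sets that
  carry almost all of the integral of its norm.\<close>

section \<open>The inner product\<close>

lemma cinner_add_right: "cinner x (y + z) = cinner x y + cinner x (z :: 'a::complex_inner)"
  by (metis cinner_add_left cinner_commute complex_cnj_add)

lemma cinner_scaleC_right: "cinner x (c *\<^sub>C y) = cnj c * cinner x (y :: 'a::complex_inner)"
  by (metis cinner_scaleC_left cinner_commute complex_cnj_mult)

lemma cinner_self: "cinner x x = complex_of_real ((norm (x :: 'a::complex_inner))\<^sup>2)"
proof (rule complex_eqI)
  show "Re (cinner x x) = Re (complex_of_real ((norm x)\<^sup>2))"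
    by (simp add: norm_eq_sqrt_cinner cinner_ge_zero)
  have "Im (cinner x x) = - Im (cinner x x)"
    using arg_cong[OF cinner_commute[of x x], of Im] by simp
  then show "Im (cinner x x) = Im (complex_of_real ((norm x)\<^sup>2))"
    by (simp del: of_real_power)
qed

text \<open>The discriminant argument, stated once so that it serves both the Cauchy--Schwarz inequality
  of the inner product and the one of a positive quadratic form.\<close>

lemma square_le_of_quadratic_nonneg:
  fixes a b c :: real
  assumes "\<And>t. 0 \<le> a + 2 * t * b + t\<^sup>2 * c"
  shows "b\<^sup>2 \<le> a * c"
proof (cases "c = 0")
  case True
  have "b = 0"
  proof (rule ccontr)
    assume "b \<noteq> 0"
    then show False
      using assms[of "- (a + 1) / (2 * b)"] True by (simp add: field_simps)
  qed
  with True show ?thesis by simp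
next
  case False
  have "0 \<le> c"
  proof (rule ccontr)
    assume "\<not> 0 \<le> c"
    \<comment> \<open>If \<open>c < 0\<close>, the quadratic is negative at this \<open>t\<close>, where \<open>t * c\<close> outweighs the other coefficients.\<close>
    define t where "t = 1 + (2 * \<bar>b\<bar> + \<bar>a\<bar>) / (- c)"
    have c: "c < 0" using \<open>\<not> 0 \<le> c\<close> by simp
    have t: "1 \<le> t" using c divide_nonneg_pos[of "2 * \<bar>b\<bar> + \<bar>a\<bar>" "- c"] by (simp add: t_def)
    have e: "t * c = c - 2 * \<bar>b\<bar> - \<bar>a\<bar>" using c by (simp add: t_def distrib_right left_diff_distrib add_divide_distrib)
    have "a + 2 * t * b + t\<^sup>2 * c = a + t * (2 * b + t * c)"
      by (simp add: power2_eq_square algebra_simps)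
    also have "\<dots> \<le> a + t * (c - \<bar>a\<bar>)"
      using t unfolding e by (intro add_left_mono mult_left_mono) auto
    also have "\<dots> \<le> a + 1 * (c - \<bar>a\<bar>)"
      using t c by (intro add_left_mono mult_right_mono_neg) auto
    also have "\<dots> < 0" using c by simp
    finally show False using assms[of t] by simp
  qed
  with False have c: "0 < c" by simp
  have "0 \<le> a + 2 * (- b / c) * b + (- b / c)\<^sup>2 * c" by (rule assms)
  also have "\<dots> = a - b\<^sup>2 / c" using c by (simp add: power2_eq_square field_simps)
  finally show ?thesis using c by (simp add: field_simps)
qed

lemma Re_cinner_commute: "Re (cinner x y) = Re (cinner y (x :: 'a::complex_inner))"
  by (subst cinner_commute) simp

lemma cinner_scaleR_left: "cinner (r *\<^sub>R x) (y :: 'a::complex_inner) = r *\<^sub>R cinner x y"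
  by (simp add: scaleR_scaleC cinner_scaleC_left scaleR_conv_of_real)

lemma cinner_scaleR_right: "cinner x (r *\<^sub>R (y :: 'a::complex_inner)) = r *\<^sub>R cinner x y"
  by (simp add: scaleR_scaleC cinner_scaleC_right scaleR_conv_of_real)

lemma Re_cinner_le: "\<bar>Re (cinner x y)\<bar> \<le> norm x * norm (y :: 'a::complex_inner)"
proof -
  have "(Re (cinner x y))\<^sup>2 \<le> (norm x)\<^sup>2 * (norm y)\<^sup>2"
  proof (rule square_le_of_quadratic_nonneg)
    fix t
    have "0 \<le> Re (cinner (x + t *\<^sub>R y) (x + t *\<^sub>R y))" by (rule cinner_ge_zero)
    also have "\<dots> = (norm x)\<^sup>2 + 2 * t * Re (cinner x y) + t\<^sup>2 * (norm y)\<^sup>2"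
      using Re_cinner_commute[of y x]
      by (simp add: cinner_add_left cinner_add_right cinner_scaleR_left cinner_scaleR_right
          cinner_self[of x] cinner_self[of y] power2_eq_square algebra_simps)
    finally show "0 \<le> (norm x)\<^sup>2 + 2 * t * Re (cinner x y) + t\<^sup>2 * (norm y)\<^sup>2" .
  qed
  then show ?thesis
    by (metis abs_le_square_iff abs_mult abs_norm_cancel power_mult_distrib)
qed

lemma norm_cinner_le: "cmod (cinner x y) \<le> norm x * norm (y :: 'a::complex_inner)"
proof (cases "cinner x y = 0")
  case False
  \<comment> \<open>A unit scalar that rotates \<open>cinner x y\<close> onto the positive real axis.\<close>
  define u where "u = cnj (cinner x y) / cmod (cinner x y)"
  have u: "cmod u = 1" using False by (simp add: u_def norm_divide)
  have "cinner (u *\<^sub>C x) y = cmod (cinner x y)"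
    using False complex_norm_square[of "cinner x y"]
    by (simp add: cinner_scaleC_left u_def power2_eq_square field_simps)
  then have "cmod (cinner x y) = Re (cinner (u *\<^sub>C x) y)" by simp
  also have "\<dots> \<le> norm (u *\<^sub>C x) * norm y"
    using Re_cinner_le[of "u *\<^sub>C x" y] by linarith
  finally show ?thesis by (simp add: norm_scaleC u)
qed auto

lemma bounded_bilinear_cinner: "bounded_bilinear (cinner :: 'a::complex_inner \<Rightarrow> _)"
  by standard (auto simp: cinner_add_left cinner_add_right cinner_scaleR_left cinner_scaleR_right
      intro!: exI[of _ 1] norm_cinner_le)

interpretation cinner: bounded_bilinear "cinner :: 'a::complex_inner \<Rightarrow> 'a \<Rightarrow> complex"
  by (rule bounded_bilinear_cinner)

lemma scaleC_diff_right: "c *\<^sub>C (x - y) = c *\<^sub>C x - c *\<^sub>C (y :: 'a::complex_inner)"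
  by (rule linear_diff[OF bounded_linear.linear[OF bounded_linear_scaleC]])

lemma scaleC_scaleR_commute: "c *\<^sub>C (r *\<^sub>R x) = r *\<^sub>R c *\<^sub>C (x :: 'a::complex_inner)"
  by (simp add: scaleR_scaleC scaleC_scaleC mult.commute)

lemma eq_if_cinner_eq:
  fixes x y :: "'a::complex_inner"
  assumes "\<And>z. cinner x z = cinner y z"
  shows "x = y"
proof -
  have "cinner (x - y) (x - y) = 0" by (simp add: cinner.diff_left assms)
  then show ?thesis by (simp add: cinner_eq_zero_iff)
qed

section \<open>Self-adjoint operators and their quadratic forms\<close>

lemma bounded_ops_simps [simp, intro]:
  "id_blinfun \<in> bounded_ops" "0 \<in> bounded_ops"
  "A \<in> bounded_ops \<Longrightarrow> B \<in> bounded_ops \<Longrightarrow> A + B \<in> bounded_ops"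
  "A \<in> bounded_ops \<Longrightarrow> B \<in> bounded_ops \<Longrightarrow> A - B \<in> bounded_ops"
  "A \<in> bounded_ops \<Longrightarrow> r *\<^sub>R A \<in> bounded_ops"
  "A \<in> bounded_ops \<Longrightarrow> B \<in> bounded_ops \<Longrightarrow> A o\<^sub>L B \<in> bounded_ops"
  unfolding bounded_ops_def
  by (auto simp: blinfun.bilinear_simps scaleC_add_right scaleC_diff_right scaleC_scaleR_commute
      bounded_linear_scaleC linear_0[OF bounded_linear.linear[OF bounded_linear_scaleC]])

lemma closed_bounded_ops: "closed (bounded_ops :: ('a::complex_inner \<Rightarrow>\<^sub>L 'a) set)"
proof -
  have eq: "bounded_ops = (\<Inter>c. \<Inter>x. {A :: 'a \<Rightarrow>\<^sub>L 'a. A (c *\<^sub>C x) = c *\<^sub>C A x})"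
    by (auto simp: bounded_ops_def)
  have "closed {A :: 'a \<Rightarrow>\<^sub>L 'a. A (c *\<^sub>C x) = c *\<^sub>C A x}" for c and x :: 'a
    by (intro closed_Collect_eq continuous_intros
        bounded_linear.continuous_on[OF bounded_linear_scaleC])
  then show ?thesis unfolding eq by (intro closed_INT ballI)
qed

lemma self_adjointD:
  assumes "self_adjoint A"
  shows "cinner (A x) y = cinner x (A y)" "A \<in> bounded_ops"
  using assms by (auto simp: self_adjoint_def is_adjoint_def)

lemma self_adjointI:
  assumes "A \<in> bounded_ops" "\<And>x y. cinner (A x) y = cinner x (A y)"
  shows "self_adjoint A"
  using assms by (auto simp: self_adjoint_def is_adjoint_def)

lemma self_adjoint_simps [simp, intro]:
  "self_adjoint id_blinfun" "self_adjoint 0"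
  "self_adjoint A \<Longrightarrow> self_adjoint B \<Longrightarrow> self_adjoint (A + B)"
  "self_adjoint A \<Longrightarrow> self_adjoint B \<Longrightarrow> self_adjoint (A - B)"
  "self_adjoint A \<Longrightarrow> self_adjoint (r *\<^sub>R A)"
  by (auto intro!: self_adjointI simp: self_adjointD blinfun.bilinear_simps
      cinner.add_left cinner.add_right cinner.diff_left cinner.diff_right cinner.scaleR_left
      cinner.scaleR_right)

lemma self_adjoint_compose:
  assumes "self_adjoint A" "self_adjoint B" "A o\<^sub>L B = B o\<^sub>L A"
  shows "self_adjoint (A o\<^sub>L B)"
proof (rule self_adjointI)
  fix x y
  have "cinner ((A o\<^sub>L B) x) y = cinner x ((B o\<^sub>L A) y)"
    by (simp add: self_adjointD[OF assms(1)] self_adjointD[OF assms(2)])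
  then show "cinner ((A o\<^sub>L B) x) y = cinner x ((A o\<^sub>L B) y)"
    by (simp add: assms(3))
qed (use assms in \<open>auto simp: self_adjointD\<close>)

lemma self_adjoint_sandwich:
  assumes "self_adjoint A" "self_adjoint B"
  shows "self_adjoint (A o\<^sub>L B o\<^sub>L A)"
  using assms by (intro self_adjointI) (auto simp: self_adjointD)

lemma closed_self_adjoint: "closed {A :: 'a::complex_inner \<Rightarrow>\<^sub>L 'a. self_adjoint A}"
proof -
  have eq: "{A. self_adjoint A} = bounded_ops \<inter> (\<Inter>x. \<Inter>y. {A :: 'a \<Rightarrow>\<^sub>L 'a. cinner (A x) y = cinner x (A y)})"
    by (auto simp: self_adjoint_def is_adjoint_def)
  have "closed {A :: 'a \<Rightarrow>\<^sub>L 'a. cinner (A x) y = cinner x (A y)}" for x y :: 'a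
    by (intro closed_Collect_eq continuous_intros cinner.continuous_on)
  then show ?thesis unfolding eq by (intro closed_Int closed_INT ballI closed_bounded_ops)
qed

text \<open>All order statements below are about this real quadratic form: the Loewner order compares it
  pointwise, and it is linear in the operator.\<close>

definition quad :: "('a::complex_inner \<Rightarrow>\<^sub>L 'a) \<Rightarrow> 'a \<Rightarrow> real" where
  "quad A x = Re (cinner (A x) x)"

lemma quad_simps [simp]:
  "quad (A + B) x = quad A x + quad B x"
  "quad (A - B) x = quad A x - quad B x"
  "quad (r *\<^sub>R A) x = r * quad A x"
  "quad id_blinfun x = (norm x)\<^sup>2"
  "quad 0 x = 0"
  by (simp_all add: quad_def blinfun.bilinear_simps cinner.add_left cinner.diff_left
      cinner.scaleR_left cinner_self del: of_real_power)

lemma quad_sandwich: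
  assumes "self_adjoint A"
  shows "quad (A o\<^sub>L B o\<^sub>L A) x = quad B (A x)"
  by (simp add: quad_def self_adjointD[OF assms])

lemma quad_square:
  assumes "self_adjoint A"
  shows "quad (A o\<^sub>L A) x = (norm (A x))\<^sup>2"
  by (simp add: quad_def self_adjointD[OF assms] cinner_self del: of_real_power)

lemma loewner_le_iff_quad:
  "A \<preceq> B \<longleftrightarrow> self_adjoint A \<and> self_adjoint B \<and> (\<forall>x. quad A x \<le> quad B x)"
  by (simp add: loewner_le_def quad_def)

lemma abs_quad_le: "\<bar>quad A x\<bar> \<le> norm A * (norm x)\<^sup>2"
proof -
  have "\<bar>quad A x\<bar> \<le> norm (A x) * norm x" unfolding quad_def by (rule Re_cinner_le)
  also have "\<dots> \<le> norm A * norm x * norm x" by (intro mult_right_mono norm_blinfun) auto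
  finally show ?thesis by (simp add: power2_eq_square mult.assoc)
qed

text \<open>For self-adjoint \<open>A\<close>, polarization expresses \<open>4 * Re (cinner (A x) y)\<close> through values of the
  quadratic form, and the parallelogram law bounds those; then \<open>y\<close> is taken proportional to \<open>A x\<close>.\<close>

lemma norm_le_of_quad_bound:
  assumes A: "self_adjoint A" and b: "\<And>x. \<bar>quad A x\<bar> \<le> c * (norm x)\<^sup>2"
    and c: "0 \<le> c"
  shows "norm A \<le> c"
proof -
  have pol: "4 * Re (cinner (A x) y) \<le> 2 * d * ((norm x)\<^sup>2 + (norm y)\<^sup>2)"
    if d: "c \<le> d" for x y d
  proof -
    have s: "Re (cinner (A y) x) = Re (cinner (A x) y)"
      by (simp add: self_adjointD[OF A] Re_cinner_commute[of y])
    have "4 * Re (cinner (A x) y) = quad A (x + y) - quad A (x - y)"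
      by (simp add: quad_def blinfun.bilinear_simps cinner.add_left cinner.add_right
          cinner.diff_left cinner.diff_right s)
    also have "\<dots> \<le> c * (norm (x + y))\<^sup>2 + c * (norm (x - y))\<^sup>2"
      using b[of "x + y"] b[of "x - y"] by linarith
    also have "\<dots> \<le> d * (norm (x + y))\<^sup>2 + d * (norm (x - y))\<^sup>2"
      using d by (intro add_mono mult_right_mono) auto
    also have "\<dots> = d * (quad id_blinfun (x + y) + quad id_blinfun (x - y))"
      by (simp add: algebra_simps)
    also have "\<dots> = d * (2 * quad id_blinfun x + 2 * quad id_blinfun y)"
      by (simp add: quad_def blinfun.bilinear_simps cinner.add_left cinner.add_right
          cinner.diff_left cinner.diff_right)
    finally show ?thesis by (simp add: algebra_simps)
  qed
  \<comment> \<open>A bound \<open>d > c\<close> is positive, so that one may divide by it.\<close>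
  have le: "norm A \<le> d" if d: "c < d" for d
  proof (rule norm_blinfun_bound)
    have d0: "0 < d" using c d by linarith
    then show "0 \<le> d" by simp
    fix x
    have "4 * Re (cinner (A x) ((1 / d) *\<^sub>R A x))
        \<le> 2 * d * ((norm x)\<^sup>2 + (norm ((1 / d) *\<^sub>R A x))\<^sup>2)"
      by (rule pol) (use d in simp)
    then have "4 * ((norm (A x))\<^sup>2 / d) \<le> 2 * d * ((norm x)\<^sup>2 + (norm (A x))\<^sup>2 / d\<^sup>2)"
      using d0 by (simp add: cinner.scaleR_right cinner_self power_mult_distrib power_divide
          del: of_real_power)
    then have "(norm (A x))\<^sup>2 \<le> d\<^sup>2 * (norm x)\<^sup>2"
      using d0 by (simp add: field_simps power2_eq_square)
    then have "(norm (A x))\<^sup>2 \<le> (d * norm x)\<^sup>2" by (simp add: power_mult_distrib)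
    then show "norm (A x) \<le> d * norm x"
      by (rule power2_le_imp_le) (use d0 in simp)
  qed
  then show ?thesis by (rule dense_ge)
qed

text \<open>Cauchy--Schwarz for the positive form of \<open>A\<close>, applied to \<open>x\<close> and \<open>A x\<close>.  It turns a lower bound
  for \<open>norm (A x)\<close> into one for the quadratic form.\<close>

lemma norm_apply_square_le_quad:
  assumes A: "self_adjoint A" and pos: "\<And>x. 0 \<le> quad A x"
  shows "(norm (A x))\<^sup>2 \<le> norm A * quad A x"
proof -
  have "(Re (cinner (A x) (A x)))\<^sup>2 \<le> quad A x * quad A (A x)"
  proof (rule square_le_of_quadratic_nonneg)
    fix t
    have s: "Re (cinner (A (A x)) x) = Re (cinner (A x) (A x))"
      by (simp add: self_adjointD[OF A])
    have "0 \<le> quad A (x + t *\<^sub>R A x)" by (rule pos)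
    also have "\<dots> = quad A x + 2 * t * Re (cinner (A x) (A x)) + t\<^sup>2 * quad A (A x)"
      by (simp add: quad_def blinfun.bilinear_simps cinner.add_left cinner.add_right
          cinner.scaleR_left cinner.scaleR_right s power2_eq_square algebra_simps)
    finally show "0 \<le> quad A x + 2 * t * Re (cinner (A x) (A x)) + t\<^sup>2 * quad A (A x)" .
  qed
  also have "Re (cinner (A x) (A x)) = (norm (A x))\<^sup>2"
    by (simp add: cinner_self del: of_real_power)
  also have "quad A x * quad A (A x) \<le> quad A x * (norm A * (norm (A x))\<^sup>2)"
    using abs_quad_le[of A "A x"] pos by (intro mult_left_mono) auto
  finally have le: "(norm (A x))\<^sup>2 * (norm (A x))\<^sup>2 \<le> (norm A * quad A x) * (norm (A x))\<^sup>2"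
    by (simp add: power2_eq_square mult_ac)
  show ?thesis
  proof (cases "A x = 0")
    case True
    then show ?thesis using pos[of x] by (simp add: mult_nonneg_nonneg)
  next
    case False
    then have "0 < (norm (A x))\<^sup>2" by simp
    with le show ?thesis by (rule mult_right_le_imp_le)
  qed
qed

section \<open>Invertible operators\<close>

definition op_unit :: "('a::complex_inner \<Rightarrow>\<^sub>L 'a) \<Rightarrow> bool" where
  "op_unit A \<longleftrightarrow> (\<exists>B\<in>bounded_ops. A o\<^sub>L B = id_blinfun \<and> B o\<^sub>L A = id_blinfun)"

lemma id_compose [simp]: "id_blinfun o\<^sub>L A = A" "A o\<^sub>L id_blinfun = A"
  by (auto intro: blinfun_eqI)

lemma compose_assoc: "(A o\<^sub>L B) o\<^sub>L C = A o\<^sub>L (B o\<^sub>L C)"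
  by (auto intro: blinfun_eqI)

lemma compose_linear:
  "A o\<^sub>L (B + C) = (A o\<^sub>L B) + (A o\<^sub>L C)" "(A + B) o\<^sub>L C = (A o\<^sub>L C) + (B o\<^sub>L C)"
  "A o\<^sub>L (B - C) = (A o\<^sub>L B) - (A o\<^sub>L C)" "(A - B) o\<^sub>L C = (A o\<^sub>L C) - (B o\<^sub>L C)"
  "A o\<^sub>L (r *\<^sub>R B) = r *\<^sub>R (A o\<^sub>L B)" "(r *\<^sub>R A) o\<^sub>L B = r *\<^sub>R (A o\<^sub>L B)"
  "0 o\<^sub>L B = 0" "A o\<^sub>L 0 = 0"
  by (auto intro!: blinfun_eqI simp: blinfun.bilinear_simps)

lemma op_unit_compose:
  assumes "op_unit A" "op_unit B"
  shows "op_unit (A o\<^sub>L B)"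
proof -
  obtain A' B' where A: "A' \<in> bounded_ops" "A o\<^sub>L A' = id_blinfun" "A' o\<^sub>L A = id_blinfun"
    and B: "B' \<in> bounded_ops" "B o\<^sub>L B' = id_blinfun" "B' o\<^sub>L B = id_blinfun"
    using assms by (auto simp: op_unit_def)
  have "(A o\<^sub>L B) o\<^sub>L (B' o\<^sub>L A') = A o\<^sub>L ((B o\<^sub>L B') o\<^sub>L A')" by (simp add: compose_assoc)
  moreover have "(B' o\<^sub>L A') o\<^sub>L (A o\<^sub>L B) = B' o\<^sub>L ((A' o\<^sub>L A) o\<^sub>L B)" by (simp add: compose_assoc)
  ultimately show ?thesis
    unfolding op_unit_def using A B by (intro bexI[of _ "B' o\<^sub>L A'"]) auto
qed

lemma op_unit_scaleR:
  assumes "op_unit A" "r \<noteq> 0"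
  shows "op_unit (r *\<^sub>R A)"
proof -
  obtain B where B: "B \<in> bounded_ops" "A o\<^sub>L B = id_blinfun" "B o\<^sub>L A = id_blinfun"
    using assms(1) by (auto simp: op_unit_def)
  then have "A (B x) = x" "B (A x) = x" for x
    by (metis blinfun_apply_blinfun_compose id_blinfun.rep_eq id_apply)+
  then show ?thesis
    unfolding op_unit_def using B(1) assms(2)
    by (intro bexI[of _ "inverse r *\<^sub>R B"]) (auto intro!: blinfun_eqI simp: blinfun.bilinear_simps)
qed

lemma op_unit_id: "op_unit id_blinfun"
  unfolding op_unit_def by (intro bexI[of _ id_blinfun]) auto

text \<open>The Neumann series: its partial sums telescope against \<open>id_blinfun - R\<close>, on either side, to
  \<open>id_blinfun - R ^ n\<close>.\<close>

lemma op_unit_id_diff: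
  fixes R :: "'a::chilbert_space \<Rightarrow>\<^sub>L 'a"
  assumes R: "R \<in> bounded_ops" and lt: "norm R < 1"
  shows "op_unit (id_blinfun - R)"
proof -
  define P where "P n = ((\<lambda>B. R o\<^sub>L B) ^^ n) id_blinfun" for n
  have P0: "P 0 = id_blinfun" and PS: "P (Suc n) = R o\<^sub>L P n" for n
    by (simp_all add: P_def)
  have Pc: "P n o\<^sub>L R = R o\<^sub>L P n" for n
    by (induction n) (simp_all add: P0 PS compose_assoc)
  have Pb: "P n \<in> bounded_ops" for n
    by (induction n) (simp_all add: P0 PS R)
  have Pn: "norm (P n) \<le> norm R ^ n" for n
  proof (induction n)
    case 0
    show ?case unfolding P0 by (rule norm_blinfun_bound) auto
  next
    case (Suc n)
    have "norm (P (Suc n)) \<le> norm R * norm (P n)" unfolding PS by (rule norm_blinfun_compose)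
    also have "\<dots> \<le> norm R * norm R ^ n" by (intro mult_left_mono Suc) auto
    finally show ?case by simp
  qed
  have "summable (\<lambda>n. norm (P n))"
    by (rule summable_comparison_test'[OF summable_geometric[of "norm R"], of 0])
       (use lt Pn in auto)
  then have "summable P" by (rule summable_norm_cancel)
  then obtain S where S: "(\<lambda>n. \<Sum>k<n. P k) \<longlonglongrightarrow> S"
    by (auto simp: summable_def sums_def)
  have P_lim: "P \<longlonglongrightarrow> 0" using \<open>summable P\<close> by (rule summable_LIMSEQ_zero)
  have Sb: "S \<in> bounded_ops"
  proof (rule closed_sequentially[OF closed_bounded_ops _ S])
    fix n show "(\<Sum>k<n. P k) \<in> bounded_ops" by (induction n) (auto simp: Pb)
  qed
  have l: "(id_blinfun - R) o\<^sub>L (\<Sum>k<n. P k) = id_blinfun - P n" for n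
  proof (induction n)
    case (Suc n)
    have "(id_blinfun - R) o\<^sub>L (\<Sum>k<Suc n. P k)
        = ((id_blinfun - R) o\<^sub>L (\<Sum>k<n. P k)) + (P n - P (Suc n))"
      by (simp add: compose_linear(1) compose_linear(4)[of _ _ "P n"] PS)
    then show ?case by (simp add: Suc)
  qed (simp add: compose_linear P0)
  have r: "(\<Sum>k<n. P k) o\<^sub>L (id_blinfun - R) = id_blinfun - P n" for n
  proof (induction n)
    case (Suc n)
    have "(\<Sum>k<Suc n. P k) o\<^sub>L (id_blinfun - R)
        = ((\<Sum>k<n. P k) o\<^sub>L (id_blinfun - R)) + (P n - P (Suc n))"
      by (simp add: compose_linear(2) compose_linear(3)[of "P n"] PS Pc)
    then show ?case by (simp add: Suc)
  qed (simp add: compose_linear P0)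
  have i: "(\<lambda>n. id_blinfun - P n) \<longlonglongrightarrow> id_blinfun"
    using tendsto_diff[OF tendsto_const P_lim] by simp
  have "(\<lambda>n. (id_blinfun - R) o\<^sub>L (\<Sum>k<n. P k)) \<longlonglongrightarrow> ((id_blinfun - R) o\<^sub>L S)"
    by (rule bounded_bilinear.tendsto[OF bounded_bilinear_blinfun_compose tendsto_const S])
  then have 1: "(id_blinfun - R) o\<^sub>L S = id_blinfun"
    using LIMSEQ_unique i unfolding l by blast
  have "(\<lambda>n. (\<Sum>k<n. P k) o\<^sub>L (id_blinfun - R)) \<longlonglongrightarrow> (S o\<^sub>L (id_blinfun - R))"
    by (rule bounded_bilinear.tendsto[OF bounded_bilinear_blinfun_compose S tendsto_const])
  then have 2: "S o\<^sub>L (id_blinfun - R) = id_blinfun"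
    using LIMSEQ_unique i unfolding r by blast
  show ?thesis unfolding op_unit_def using Sb 1 2 by blast
qed

text \<open>A form bounded below by \<open>c > 0\<close> makes \<open>A\<close> a multiple \<open>k\<close> of \<open>id_blinfun - R\<close> with
  \<open>norm R \<le> 1 - c / k\<close>, so the Neumann series applies.\<close>

lemma op_unit_if_quad_ge:
  fixes A :: "'a::chilbert_space \<Rightarrow>\<^sub>L 'a"
  assumes A: "self_adjoint A" and c: "0 < c" and ge: "\<And>x. c * (norm x)\<^sup>2 \<le> quad A x"
  shows "op_unit A"
proof -
  define k where "k = norm A + c"
  have k: "0 < k" "c \<le> k" using c by (auto simp: k_def add_nonneg_pos)
  define R where "R = id_blinfun - (1 / k) *\<^sub>R A"
  have "norm R \<le> 1 - c / k"
  proof (rule norm_le_of_quad_bound)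
    show "self_adjoint R" using A by (simp add: R_def)
    show "0 \<le> 1 - c / k" using k by simp
    fix x
    have q: "quad R x = (norm x)\<^sup>2 - quad A x / k" by (simp add: R_def)
    have "quad A x \<le> k * (norm x)\<^sup>2"
    proof -
      have "quad A x \<le> norm A * (norm x)\<^sup>2" using abs_quad_le[of A x] by linarith
      also have "\<dots> \<le> k * (norm x)\<^sup>2" using c by (intro mult_right_mono) (auto simp: k_def)
      finally show ?thesis .
    qed
    then have "quad A x / k \<le> (norm x)\<^sup>2" using k by (simp add: field_simps)
    moreover have "c * (norm x)\<^sup>2 / k \<le> quad A x / k"
      using ge[of x] k by (intro divide_right_mono) auto
    ultimately show "\<bar>quad R x\<bar> \<le> (1 - c / k) * (norm x)\<^sup>2"
      unfolding q by (simp add: algebra_simps)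
  qed
  moreover have "0 < c / k" using c k by simp
  ultimately have "norm R < 1" by linarith
  moreover have "R \<in> bounded_ops" using A by (auto simp: R_def self_adjointD)
  ultimately have "op_unit (k *\<^sub>R (id_blinfun - R))"
    using k by (intro op_unit_scaleR op_unit_id_diff) auto
  moreover have "k *\<^sub>R (id_blinfun - R) = A" using k by (simp add: R_def)
  ultimately show ?thesis by simp
qed

text \<open>Conversely, an invertible positive operator is bounded below, because \<open>norm x\<close> is at most
  \<open>norm B * norm (A x)\<close> for the inverse \<open>B\<close>.\<close>

lemma quad_ge_if_op_unit:
  assumes A: "self_adjoint A" and pos: "\<And>x. 0 \<le> quad A x" and unit: "op_unit A"
  obtains c where "0 < c" "\<And>x. c * (norm x)\<^sup>2 \<le> quad A x"
proof -
  obtain B where B: "A o\<^sub>L B = id_blinfun" "B o\<^sub>L A = id_blinfun"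
    using unit by (auto simp: op_unit_def)
  \<comment> \<open>The summand 1 keeps \<open>k\<close> positive on the zero space as well.\<close>
  define k where "k = (norm B)\<^sup>2 * norm A + 1"
  have k: "0 < k" by (simp add: k_def add_nonneg_pos)
  have "(norm x)\<^sup>2 \<le> k * quad A x" for x
  proof -
    have "B (A x) = x" using B(2) by (metis blinfun_apply_blinfun_compose id_blinfun.rep_eq id_apply)
    then have "(norm x)\<^sup>2 \<le> (norm B * norm (A x))\<^sup>2"
      using norm_blinfun[of B "A x"] by (intro power_mono) auto
    also have "\<dots> \<le> (norm B)\<^sup>2 * (norm A * quad A x)"
      unfolding power_mult_distrib
      by (intro mult_left_mono norm_apply_square_le_quad[OF A pos]) auto
    also have "\<dots> \<le> k * quad A x"
      using pos[of x] by (simp add: k_def algebra_simps)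
    finally show ?thesis .
  qed
  then show ?thesis
    using k by (intro that[of "1 / k"]) (auto simp: field_simps)
qed

section \<open>Polynomials of a self-adjoint operator\<close>

text \<open>A summation bound that may exceed the degree, so that sums and products of polynomials can be
  compared coefficientwise.\<close>

lemma op_poly_upto:
  assumes "degree p \<le> n"
  shows "op_poly E p A = (\<Sum>k\<le>n. coeff p k *\<^sub>R (((\<lambda>B. A o\<^sub>L B) ^^ k) E))"
  unfolding op_poly_def
  by (rule sum.mono_neutral_left) (use assms in \<open>auto simp: coeff_eq_0\<close>)

lemma op_poly_0 [simp]: "op_poly E 0 A = 0"
  by (simp add: op_poly_def)

lemma op_poly_pCons: "op_poly E (pCons c p) A = c *\<^sub>R E + (A o\<^sub>L op_poly E p A)"
proof -
  have "op_poly E (pCons c p) A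
      = (\<Sum>k\<le>Suc (degree p). coeff (pCons c p) k *\<^sub>R (((\<lambda>B. A o\<^sub>L B) ^^ k) E))"
    by (rule op_poly_upto) (rule degree_pCons_le)
  also have "\<dots> = c *\<^sub>R E + (\<Sum>k\<le>degree p. coeff p k *\<^sub>R (A o\<^sub>L (((\<lambda>B. A o\<^sub>L B) ^^ k) E)))"
    by (simp add: sum.atMost_Suc_shift del: sum.atMost_Suc)
  also have "(\<Sum>k\<le>degree p. coeff p k *\<^sub>R (A o\<^sub>L (((\<lambda>B. A o\<^sub>L B) ^^ k) E))) = (A o\<^sub>L op_poly E p A)"
    unfolding op_poly_def
    by (simp add: bounded_bilinear.sum_right[OF bounded_bilinear_blinfun_compose] compose_linear)
  finally show ?thesis .
qed

lemma op_poly_add: "op_poly E (p + q) A = op_poly E p A + op_poly E q A"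
proof -
  define n where "n = max (degree p) (degree q)"
  have "degree p \<le> n" "degree q \<le> n" "degree (p + q) \<le> n"
    by (auto simp: n_def degree_add_le_max)
  then show ?thesis
    by (simp add: op_poly_upto[of _ n] sum.distrib scaleR_add_left)
qed

lemma op_poly_smult: "op_poly E (smult c p) A = c *\<^sub>R op_poly E p A"
  by (simp add: op_poly_upto[of _ "degree p"] degree_smult_le scaleR_sum_right)

lemma op_poly_diff: "op_poly E (p - q) A = op_poly E p A - op_poly E q A"
  using op_poly_add[of E p "smult (-1) q" A]
  by (simp only: op_poly_smult) simp

lemma op_poly_mult:
  "op_poly id_blinfun (p * q) A = op_poly id_blinfun p A o\<^sub>L op_poly id_blinfun q A"
proof (induction p)
  case (pCons c p)
  then show ?case
    by (simp add: mult_pCons_left op_poly_add op_poly_smult op_poly_pCons compose_linear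
        compose_assoc)
qed (simp add: compose_linear)

lemma op_poly_const: "op_poly id_blinfun [:c:] A = c *\<^sub>R id_blinfun"
  by (simp add: op_poly_pCons compose_linear)

lemma op_poly_linear: "op_poly id_blinfun [:c, 1:] A = A + c *\<^sub>R id_blinfun"
  by (simp add: op_poly_pCons compose_linear)

lemma op_poly_commute:
  "(op_poly id_blinfun p A o\<^sub>L op_poly id_blinfun q A)
    = (op_poly id_blinfun q A o\<^sub>L op_poly id_blinfun p A)"
  by (metis op_poly_mult mult.commute)

lemma self_adjoint_op_poly:
  assumes A: "self_adjoint A"
  shows "self_adjoint (op_poly id_blinfun p A)"
proof (induction p)
  case (pCons c p)
  have "(A o\<^sub>L op_poly id_blinfun p A) = (op_poly id_blinfun p A o\<^sub>L A)"
    using op_poly_commute[of "[:0, 1:]" A p] by (simp add: op_poly_linear)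
  with pCons A show ?case
    by (simp add: op_poly_pCons self_adjoint_compose)
qed simp

lemma continuous_on_op_poly:
  assumes "continuous_on S F"
  shows "continuous_on S (\<lambda>s. op_poly id_blinfun p (F s))"
proof (induction p)
  case (pCons c p)
  then show ?case unfolding op_poly_pCons
    by (intro continuous_intros assms
        bounded_bilinear.continuous_on[OF bounded_bilinear_blinfun_compose])
qed simp

section \<open>Real spectrum\<close>

abbreviation real_spectrum :: "('a::complex_inner \<Rightarrow>\<^sub>L 'a) \<Rightarrow> real set" where
  "real_spectrum A \<equiv> {t. complex_of_real t \<in> op_spectrum id_blinfun A}"

lemma scaleC_of_real_blinfun: "complex_of_real t *\<^sub>C A = t *\<^sub>R (A :: 'a::complex_inner \<Rightarrow>\<^sub>L 'a)"
  by (rule blinfun_eqI) (simp add: scaleC_blinfun.rep_eq scaleR_scaleC blinfun.bilinear_simps)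

lemma mem_real_spectrum_iff:
  "t \<in> real_spectrum A \<longleftrightarrow> \<not> op_unit (A - t *\<^sub>R id_blinfun)"
  by (simp add: op_spectrum_def op_unit_def ops_on_def scaleC_of_real_blinfun)

text \<open>The infimum of the form of \<open>A\<close> on the unit sphere lies in the spectrum: after subtracting it,
  the form is nonnegative with infimum 0, which is impossible for an invertible operator.\<close>

lemma real_spectrum_le_quad:
  fixes A :: "'a::chilbert_space \<Rightarrow>\<^sub>L 'a"
  assumes A: "self_adjoint A" and x0: "x0 \<noteq> 0"
  obtains l where "l \<in> real_spectrum A" "l * (norm x0)\<^sup>2 \<le> quad A x0"
proof -
  define R where "R = (\<lambda>x. quad A x / (norm x)\<^sup>2) ` {x. x \<noteq> 0}"
  define l where "l = Inf R"
  have bdd: "bdd_below R"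
  proof (rule bdd_belowI[of _ "- norm A"])
    fix r assume "r \<in> R"
    then obtain x where x: "x \<noteq> 0" "r = quad A x / (norm x)\<^sup>2" by (auto simp: R_def)
    have "- (norm A * (norm x)\<^sup>2) \<le> quad A x" using abs_quad_le[of A x] by linarith
    then have "- norm A * (norm x)\<^sup>2 \<le> r * (norm x)\<^sup>2" using x by simp
    then show "- norm A \<le> r" by (rule mult_right_le_imp_le) (use x in simp)
  qed
  have ge: "l * (norm x)\<^sup>2 \<le> quad A x" for x
  proof (cases "x = 0")
    case False
    then have "quad A x / (norm x)\<^sup>2 \<in> R" by (auto simp: R_def)
    then have "l \<le> quad A x / (norm x)\<^sup>2" unfolding l_def using bdd by (rule cInf_lower)
    then show ?thesis using False by (simp add: field_simps)
  qed (simp add: quad_def cinner.zero_left)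
  have "\<not> op_unit (A - l *\<^sub>R id_blinfun)"
  proof
    assume u: "op_unit (A - l *\<^sub>R id_blinfun)"
    have sa: "self_adjoint (A - l *\<^sub>R id_blinfun)" using A by auto
    have pos: "\<And>x. 0 \<le> quad (A - l *\<^sub>R id_blinfun) x" using ge by simp
    obtain c where c: "0 < c" "\<And>x. c * (norm x)\<^sup>2 \<le> quad (A - l *\<^sub>R id_blinfun) x"
      using quad_ge_if_op_unit[OF sa pos u] by blast
    have "l + c \<le> Inf R"
    proof (rule cInf_greatest)
      show "R \<noteq> {}" using x0 by (auto simp: R_def)
      fix r assume "r \<in> R"
      then obtain x where x: "x \<noteq> 0" "r = quad A x / (norm x)\<^sup>2" by (auto simp: R_def)
      have "(l + c) * (norm x)\<^sup>2 \<le> quad A x" using c(2)[of x] by (simp add: algebra_simps)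
      then show "l + c \<le> r" using x by (simp add: pos_le_divide_eq)
    qed
    with c(1) show False by (simp add: l_def)
  qed
  then have "l \<in> real_spectrum A" unfolding mem_real_spectrum_iff .
  then show ?thesis using ge by (rule that)
qed

lemma map_poly_of_real_add:
  "map_poly complex_of_real (p + q) = map_poly complex_of_real p + map_poly complex_of_real q"
  by (intro poly_eqI) (simp add: coeff_map_poly)

lemma map_poly_of_real_mult:
  "map_poly complex_of_real (p * q) = map_poly complex_of_real p * map_poly complex_of_real q"
  by (intro poly_eqI) (simp add: coeff_map_poly coeff_mult)

lemma poly_map_poly_of_real:
  "poly (map_poly complex_of_real p) (complex_of_real x) = complex_of_real (poly p x)"
  by (induction p) (simp_all add: map_poly_pCons)

text \<open>A nonreal root of a real polynomial brings its conjugate along; division with remainder by the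
  quadratic leaves a real polynomial of degree at most 1 that vanishes at a nonreal point.\<close>

lemma real_quadratic_dvd:
  fixes q :: "real poly" and z :: complex
  assumes root: "poly (map_poly of_real q) z = 0" and im: "Im z \<noteq> 0"
  shows "[:(Re z)\<^sup>2 + (Im z)\<^sup>2, - 2 * Re z, 1:] dvd q"
proof -
  define s where "s = [:(Re z)\<^sup>2 + (Im z)\<^sup>2, - 2 * Re z, 1:]"
  define u where "u = coeff (q mod s) 0"
  define v where "v = coeff (q mod s) 1"
  have "degree s = 2" by (simp add: s_def)
  then have "degree (q mod s) < 2"
    using degree_mod_less[of s q] by (cases "s = 0"; cases "q mod s = 0") auto
  then have uv: "q mod s = [:u, v:]"
    unfolding u_def v_def
    by (intro poly_eqI) (auto simp: coeff_pCons coeff_eq_0 split: nat.split)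
  have s0: "poly (map_poly complex_of_real s) z = 0"
    by (rule complex_eqI)
       (auto simp: s_def map_poly_pCons power2_eq_square algebra_simps)
  have "poly (map_poly complex_of_real (q div s * s + q mod s)) z = 0"
    using root by simp
  then have "poly (map_poly complex_of_real (q mod s)) z = 0"
    using s0 by (simp only: map_poly_of_real_add map_poly_of_real_mult poly_add poly_mult) simp
  then have e: "complex_of_real u + z * complex_of_real v = 0"
    by (simp add: uv map_poly_pCons)
  have "v = 0" using arg_cong[OF e, of Im] im by simp
  moreover have "u = 0" using arg_cong[OF e, of Re] \<open>v = 0\<close> by simp
  ultimately have "q mod s = 0" by (simp add: uv)
  then show ?thesis unfolding s_def[symmetric] by (simp add: mod_eq_0_iff_dvd)
qed

text \<open>One half of the spectral mapping theorem: a nonzero polynomial without roots in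
  the real spectrum of \<open>A\<close> is invertible at \<open>A\<close>.  Over the reals it splits into linear factors, which are
  invertible at \<open>A\<close> by the definition of the spectrum, and quadratic factors
  \<open>(x - a)\<^sup>2 + b\<^sup>2\<close> with \<open>b \<noteq> 0\<close>, whose form is at least \<open>b\<^sup>2\<close>.\<close>

lemma op_unit_op_poly:
  fixes A :: "'a::chilbert_space \<Rightarrow>\<^sub>L 'a"
  assumes A: "self_adjoint A" and "q \<noteq> 0" and "\<And>t. t \<in> real_spectrum A \<Longrightarrow> poly q t \<noteq> 0"
  shows "op_unit (op_poly id_blinfun q A)"
  using assms(2,3)
proof (induction "degree q" arbitrary: q rule: less_induct)
  case less
  have step: "op_unit (op_poly id_blinfun q A)"
    if d: "s dvd q" and deg: "0 < degree s" and u: "op_unit (op_poly id_blinfun s A)" for s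
  proof -
    obtain r where r: "q = s * r" using d by (rule dvdE)
    with less(2) have "s \<noteq> 0" "r \<noteq> 0" by auto
    then have "degree r < degree q" using deg by (simp add: r degree_mult_eq)
    then have "op_unit (op_poly id_blinfun r A)"
      using \<open>r \<noteq> 0\<close> less(3) by (intro less(1)) (auto simp: r)
    then show ?thesis unfolding r op_poly_mult by (intro op_unit_compose u)
  qed
  show ?case
  proof (cases "degree q = 0")
    case True
    then obtain c where "q = [:c:]" by (rule degree_eq_zeroE)
    then show ?thesis using less(2) by (simp add: op_poly_const op_unit_scaleR op_unit_id)
  next
    case False
    have "\<not> constant (poly (map_poly complex_of_real q))"
      using False by (simp add: constant_degree degree_map_poly)
    then obtain z where z: "poly (map_poly complex_of_real q) z = 0"
      using fundamental_theorem_of_algebra by blast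
    show ?thesis
    proof (cases "Im z = 0")
      case True
      then have "z = complex_of_real (Re z)" by (simp add: complex_eq_iff)
      with z have "poly (map_poly complex_of_real q) (complex_of_real (Re z)) = 0" by simp
      then have 0: "poly q (Re z) = 0" by (simp only: poly_map_poly_of_real of_real_eq_0_iff)
      show ?thesis
      proof (rule step)
        show "[:- Re z, 1:] dvd q" using 0 by (simp add: poly_eq_0_iff_dvd)
        have "Re z \<notin> real_spectrum A" using 0 less(3) by blast
        then show "op_unit (op_poly id_blinfun [:- Re z, 1:] A)"
          unfolding mem_real_spectrum_iff by (simp add: op_poly_linear)
      qed simp
    next
      case False
      let ?s = "[:(Re z)\<^sup>2 + (Im z)\<^sup>2, - 2 * Re z, 1:]"
      let ?l = "[:- Re z, 1:]"
      have s: "?s = ?l * ?l + [:(Im z)\<^sup>2:]" by (simp add: power2_eq_square)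
      have q: "quad (op_poly id_blinfun ?s A) x
          = (norm (op_poly id_blinfun ?l A x))\<^sup>2 + (Im z)\<^sup>2 * (norm x)\<^sup>2" for x
        unfolding s op_poly_add op_poly_mult op_poly_const
        by (simp only: quad_simps quad_square[OF self_adjoint_op_poly[OF A]])
      show ?thesis
      proof (rule step)
        show "?s dvd q" using z False by (rule real_quadratic_dvd)
        show "op_unit (op_poly id_blinfun ?s A)"
        proof (rule op_unit_if_quad_ge)
          show "0 < (Im z)\<^sup>2" using False by simp
          show "(Im z)\<^sup>2 * (norm x)\<^sup>2 \<le> quad (op_poly id_blinfun ?s A) x" for x
            unfolding q by simp
        qed (rule self_adjoint_op_poly[OF A])
      qed simp
    qed
  qed
qed

text \<open>At each unit vector the form of \<open>p(A)\<close> is at least some spectral value of \<open>p(A)\<close>, and a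
  spectral value of \<open>p(A)\<close> is the value of \<open>p\<close> at a spectral value of \<open>A\<close>.\<close>

lemma quad_op_poly_ge:
  fixes A :: "'a::chilbert_space \<Rightarrow>\<^sub>L 'a"
  assumes A: "self_adjoint A" and c: "\<And>t. t \<in> real_spectrum A \<Longrightarrow> c \<le> poly p t"
  shows "c * (norm x)\<^sup>2 \<le> quad (op_poly id_blinfun p A) x"
proof (cases "x = 0")
  case False
  obtain l where l: "l \<in> real_spectrum (op_poly id_blinfun p A)"
    "l * (norm x)\<^sup>2 \<le> quad (op_poly id_blinfun p A) x"
    using real_spectrum_le_quad[OF self_adjoint_op_poly[OF A] False] by blast
  \<comment> \<open>If \<open>p\<close> is the constant \<open>l\<close>, a spectral value of \<open>A\<close> is still needed to compare \<open>l\<close> with \<open>c\<close>.\<close>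
  obtain t0 where t0: "t0 \<in> real_spectrum A"
    using real_spectrum_le_quad[OF A False] by blast
  have "\<not> op_unit (op_poly id_blinfun (p - [:l:]) A)"
    using l(1) unfolding mem_real_spectrum_iff op_poly_diff op_poly_const .
  then have "p - [:l:] = 0 \<or> (\<exists>t\<in>real_spectrum A. poly (p - [:l:]) t = 0)"
    using op_unit_op_poly[OF A] by blast
  then have "c \<le> l"
  proof
    assume "p - [:l:] = 0"
    then show ?thesis using c[OF t0] by simp
  qed (use c in auto)
  then have "c * (norm x)\<^sup>2 \<le> l * (norm x)\<^sup>2" by (intro mult_right_mono) auto
  with l(2) show ?thesis by linarith
qed (simp add: quad_def cinner.zero_left)

text \<open>Polynomials are controlled by their size on the spectrum alone.  This makes the limit that
  defines the functional calculus exist and be independent of the approximating polynomials.\<close>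

lemma norm_op_poly_le:
  fixes A :: "'a::chilbert_space \<Rightarrow>\<^sub>L 'a"
  assumes A: "self_adjoint A" and c: "\<And>t. t \<in> real_spectrum A \<Longrightarrow> \<bar>poly p t\<bar> \<le> c"
    and "0 \<le> c"
  shows "norm (op_poly id_blinfun p A) \<le> c"
proof (rule norm_le_of_quad_bound)
  fix x
  have "- c * (norm x)\<^sup>2 \<le> quad (op_poly id_blinfun p A) x"
    by (rule quad_op_poly_ge[OF A]) (use c in fastforce)
  moreover have "- c * (norm x)\<^sup>2 \<le> quad (op_poly id_blinfun (smult (-1) p) A) x"
    by (rule quad_op_poly_ge[OF A]) (use c in fastforce)
  then have "quad (op_poly id_blinfun p A) x \<le> c * (norm x)\<^sup>2"
    by (simp only: op_poly_smult quad_simps)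
  ultimately show "\<bar>quad (op_poly id_blinfun p A) x\<bar> \<le> c * (norm x)\<^sup>2" by linarith
qed (use assms self_adjoint_op_poly in auto)

section \<open>Continuous functional calculus\<close>

lemma op_poly_Cauchy_bound:
  fixes A :: "'a::chilbert_space \<Rightarrow>\<^sub>L 'a"
  assumes A: "self_adjoint A" and e: "0 \<le> e" "0 \<le> d"
    and p: "\<And>t. t \<in> real_spectrum A \<Longrightarrow> \<bar>poly p t - f t\<bar> \<le> e"
    and q: "\<And>t. t \<in> real_spectrum A \<Longrightarrow> \<bar>poly q t - f t\<bar> \<le> d"
  shows "norm (op_poly id_blinfun p A - op_poly id_blinfun q A) \<le> e + d"
  unfolding op_poly_diff[symmetric]
proof (rule norm_op_poly_le[OF A])
  fix t assume "t \<in> real_spectrum A"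
  from p[OF this] q[OF this] show "\<bar>poly (p - q) t\<bar> \<le> e + d" by simp
qed (use e in simp)

lemma fun_calc_tendsto:
  fixes A :: "'a::chilbert_space \<Rightarrow>\<^sub>L 'a"
  assumes A: "self_adjoint A"
    and p: "uniform_limit (real_spectrum A) (\<lambda>n. poly (p n)) f sequentially"
  shows "(\<lambda>n. op_poly id_blinfun (p n) A) \<longlonglongrightarrow> fun_calc f A"
proof -
  have ev: "\<exists>N. \<forall>n\<ge>N. \<forall>t\<in>real_spectrum A. \<bar>poly (q n) t - f t\<bar> \<le> e"
    if "uniform_limit (real_spectrum A) (\<lambda>n. poly (q n)) f sequentially" "0 < e"
    for q :: "nat \<Rightarrow> real poly" and e
    using uniform_limitD[OF that] unfolding eventually_sequentially dist_real_def
    by (meson less_imp_le)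
  have diff: "(\<lambda>n. op_poly id_blinfun (p n) A - op_poly id_blinfun (q n) A) \<longlonglongrightarrow> 0"
    if q: "uniform_limit (real_spectrum A) (\<lambda>n. poly (q n)) f sequentially" for q
  proof (rule LIMSEQ_I)
    fix e :: real assume e: "0 < e"
    obtain N M where N: "\<forall>n\<ge>N. \<forall>t\<in>real_spectrum A. \<bar>poly (p n) t - f t\<bar> \<le> e / 3"
      and M: "\<forall>n\<ge>M. \<forall>t\<in>real_spectrum A. \<bar>poly (q n) t - f t\<bar> \<le> e / 3"
      using ev[OF p, of "e / 3"] ev[OF q, of "e / 3"] e by auto
    have "norm (op_poly id_blinfun (p n) A - op_poly id_blinfun (q n) A) \<le> e / 3 + e / 3"
      if "max N M \<le> n" for n
      by (rule op_poly_Cauchy_bound[OF A]) (use N M e that in auto)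
    then show "\<exists>no. \<forall>n\<ge>no.
        norm (op_poly id_blinfun (p n) A - op_poly id_blinfun (q n) A - 0) < e"
      using e by (intro exI[of _ "max N M"]) fastforce
  qed
  have "Cauchy (\<lambda>n. op_poly id_blinfun (p n) A)"
  proof (rule CauchyI)
    fix e :: real assume e: "0 < e"
    obtain N where N: "\<forall>n\<ge>N. \<forall>t\<in>real_spectrum A. \<bar>poly (p n) t - f t\<bar> \<le> e / 3"
      using ev[OF p, of "e / 3"] e by auto
    have "norm (op_poly id_blinfun (p m) A - op_poly id_blinfun (p n) A) \<le> e / 3 + e / 3"
      if "N \<le> m" "N \<le> n" for m n
      by (rule op_poly_Cauchy_bound[OF A]) (use N e that in auto)
    then show "\<exists>M. \<forall>m\<ge>M. \<forall>n\<ge>M.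
        norm (op_poly id_blinfun (p m) A - op_poly id_blinfun (p n) A) < e"
      using e by (intro exI[of _ N]) fastforce
  qed
  then obtain Y where Y: "(\<lambda>n. op_poly id_blinfun (p n) A) \<longlonglongrightarrow> Y"
    by (auto simp: Cauchy_convergent_iff convergent_def)
  have "fun_calc f A = Y"
    unfolding fun_calc_on_def
  proof (rule the_equality)
    show "\<exists>p. uniform_limit (real_spectrum A) (\<lambda>n. poly (p n)) f sequentially \<and>
        (\<lambda>n. op_poly id_blinfun (p n) A) \<longlonglongrightarrow> Y"
      using p Y by blast
    fix Z assume "\<exists>p. uniform_limit (real_spectrum A) (\<lambda>n. poly (p n)) f sequentially \<and>
        (\<lambda>n. op_poly id_blinfun (p n) A) \<longlonglongrightarrow> Z"
    then obtain q where q: "uniform_limit (real_spectrum A) (\<lambda>n. poly (q n)) f sequentially"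
      and Z: "(\<lambda>n. op_poly id_blinfun (q n) A) \<longlonglongrightarrow> Z" by blast
    have "Y - Z = 0" by (rule LIMSEQ_unique[OF tendsto_diff[OF Y Z] diff[OF q]])
    then show "Z = Y" by simp
  qed
  with Y show ?thesis by simp
qed

lemma Weierstrass_polynomial_sequence:
  fixes f :: "real \<Rightarrow> real"
  assumes f: "continuous_on {a..b} f"
  obtains p :: "nat \<Rightarrow> real poly" where "uniform_limit {a..b} (\<lambda>n. poly (p n)) f sequentially"
proof -
  have "\<exists>p. \<forall>t\<in>{a..b}. \<bar>poly p t - f t\<bar> < 1 / real (Suc n)" for n
  proof -
    obtain g where g: "real_polynomial_function g" "\<And>t. t \<in> {a..b} \<Longrightarrow> \<bar>f t - g t\<bar> < 1 / real (Suc n)"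
      using Stone_Weierstrass_real_polynomial_function[OF compact_Icc f, of "1 / real (Suc n)"] by auto
    obtain c N where c: "g = (\<lambda>t. \<Sum>i\<le>N. c i * t ^ i)"
      using g(1) unfolding real_polynomial_function_iff_sum by blast
    have "poly (\<Sum>i\<le>N. monom (c i) i) t = g t" for t
      by (simp add: c poly_sum poly_monom)
    then show ?thesis
      using g(2) by (intro exI[of _ "\<Sum>i\<le>N. monom (c i) i"]) (auto simp: abs_minus_commute)
  qed
  then obtain p where p: "\<And>n t. t \<in> {a..b} \<Longrightarrow> \<bar>poly (p n) t - f t\<bar> < 1 / real (Suc n)"
    by metis
  have "uniform_limit {a..b} (\<lambda>n. poly (p n)) f sequentially"
  proof (rule uniform_limitI)
    fix e :: real assume "0 < e"
    then obtain N where N: "1 / real (Suc N) < e" by (rule nat_approx_posE)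
    have "dist (poly (p n) t) (f t) < e" if "N \<le> n" "t \<in> {a..b}" for n t
    proof -
      have "1 / real (Suc n) \<le> 1 / real (Suc N)" using that by (simp add: frac_le)
      with p[OF that(2), of n] N show ?thesis by (simp add: dist_real_def)
    qed
    then show "\<forall>\<^sub>F n in sequentially. \<forall>t\<in>{a..b}. dist (poly (p n) t) (f t) < e"
      unfolding eventually_sequentially by blast
  qed
  then show ?thesis by (rule that)
qed

text \<open>The functional calculus is defined through the spectrum, which is inconvenient to compute; the
  bounds that occur in practice are order bounds, and they confine the spectrum to an interval.\<close>

definition op_between :: "real \<Rightarrow> real \<Rightarrow> ('a::complex_inner \<Rightarrow>\<^sub>L 'a) \<Rightarrow> bool" where
  "op_between a b A \<longleftrightarrow>
     self_adjoint A \<and> (\<forall>x. a * (norm x)\<^sup>2 \<le> quad A x \<and> quad A x \<le> b * (norm x)\<^sup>2)"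

lemma op_betweenD:
  assumes "op_between a b A"
  shows "self_adjoint A" "a * (norm x)\<^sup>2 \<le> quad A x" "quad A x \<le> b * (norm x)\<^sup>2"
  using assms by (auto simp: op_between_def)

lemma real_spectrum_subset_Icc:
  fixes A :: "'a::chilbert_space \<Rightarrow>\<^sub>L 'a"
  assumes A: "op_between a b A"
  shows "real_spectrum A \<subseteq> {a..b}"
proof
  fix t assume t: "t \<in> real_spectrum A"
  have "\<not> t < a"
  proof
    assume "t < a"
    have "op_unit (A - t *\<^sub>R id_blinfun)"
    proof (rule op_unit_if_quad_ge)
      show "(a - t) * (norm x)\<^sup>2 \<le> quad (A - t *\<^sub>R id_blinfun) x" for x
        using op_betweenD(2)[OF A, of x] by (simp add: algebra_simps)
    qed (use \<open>t < a\<close> op_betweenD(1)[OF A] in auto)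
    with t show False unfolding mem_real_spectrum_iff by blast
  qed
  moreover have "\<not> b < t"
  proof
    assume "b < t"
    have "op_unit (t *\<^sub>R id_blinfun - A)"
    proof (rule op_unit_if_quad_ge)
      show "(t - b) * (norm x)\<^sup>2 \<le> quad (t *\<^sub>R id_blinfun - A) x" for x
        using op_betweenD(3)[OF A, of x] by (simp add: algebra_simps)
    qed (use \<open>b < t\<close> op_betweenD(1)[OF A] in auto)
    then have "op_unit ((-1) *\<^sub>R (t *\<^sub>R id_blinfun - A))" by (rule op_unit_scaleR) simp
    with t show False unfolding mem_real_spectrum_iff by simp
  qed
  ultimately show "t \<in> {a..b}" by simp
qed

context
  fixes a b :: real and A :: "'a::chilbert_space \<Rightarrow>\<^sub>L 'a"
  assumes A: "op_between a b A"
begin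

lemma fun_calc_tendsto_Icc:
  assumes "uniform_limit {a..b} (\<lambda>n. poly (p n)) f sequentially"
  shows "(\<lambda>n. op_poly id_blinfun (p n) A) \<longlonglongrightarrow> fun_calc f A"
  by (rule fun_calc_tendsto[OF op_betweenD(1)[OF A]
        uniform_limit_on_subset[OF assms real_spectrum_subset_Icc[OF A]]])

lemma fun_calc_poly: "fun_calc (poly p) A = op_poly id_blinfun p A"
  by (rule LIMSEQ_unique[OF fun_calc_tendsto_Icc[of "\<lambda>_. p"] tendsto_const])
     (simp add: uniform_limit_const)

lemma fun_calc_const: "fun_calc (\<lambda>_. c) A = c *\<^sub>R id_blinfun"
proof -
  have "poly [:c:] = (\<lambda>_. c)" by auto
  then show ?thesis using fun_calc_poly[of "[:c:]"] by (simp only: op_poly_const)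
qed

lemma fun_calc_id: "fun_calc (\<lambda>t. t) A = A"
proof -
  have "poly [:0, 1 :: real:] = (\<lambda>t. t)" by auto
  then show ?thesis using fun_calc_poly[of "[:0, 1:]"] by (simp only: op_poly_linear) simp
qed

lemma self_adjoint_fun_calc:
  assumes "continuous_on {a..b} f"
  shows "self_adjoint (fun_calc f A)"
proof -
  obtain p where p: "uniform_limit {a..b} (\<lambda>n. poly (p n)) f sequentially"
    using Weierstrass_polynomial_sequence[OF assms] .
  have "fun_calc f A \<in> {A. self_adjoint A}"
    by (rule closed_sequentially[OF closed_self_adjoint _ fun_calc_tendsto_Icc[OF p]])
       (simp add: self_adjoint_op_poly op_betweenD[OF A])
  then show ?thesis by simp
qed

lemma fun_calc_cong:
  assumes f: "continuous_on {a..b} f" and eq: "\<And>t. t \<in> {a..b} \<Longrightarrow> f t = g t"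
  shows "fun_calc f A = fun_calc g A"
proof -
  obtain p where p: "uniform_limit {a..b} (\<lambda>n. poly (p n)) f sequentially"
    using Weierstrass_polynomial_sequence[OF f] .
  have "uniform_limit {a..b} (\<lambda>n. poly (p n)) g sequentially"
    using p by (rule uniform_limit_cong'[THEN iffD1, rotated 2]) (use eq in auto)
  then show ?thesis
    using LIMSEQ_unique fun_calc_tendsto_Icc p by blast
qed

lemma fun_calc_linear_combination:
  assumes f: "continuous_on {a..b} f" and g: "continuous_on {a..b} g"
  shows "fun_calc (\<lambda>t. c * f t + d * g t) A = c *\<^sub>R fun_calc f A + d *\<^sub>R fun_calc g A"
proof -
  obtain p where p: "uniform_limit {a..b} (\<lambda>n. poly (p n)) f sequentially"
    using Weierstrass_polynomial_sequence[OF f] .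
  obtain q where q: "uniform_limit {a..b} (\<lambda>n. poly (q n)) g sequentially"
    using Weierstrass_polynomial_sequence[OF g] .
  have "uniform_limit {a..b} (\<lambda>n t. c * poly (p n) t + d * poly (q n) t)
      (\<lambda>t. c * f t + d * g t) sequentially"
    by (intro uniform_limit_add p q
        bounded_linear.uniform_limit[OF bounded_linear_mult_right])
  then have "uniform_limit {a..b} (\<lambda>n. poly (smult c (p n) + smult d (q n)))
      (\<lambda>t. c * f t + d * g t) sequentially"
    by (simp only: poly_add[abs_def] poly_smult[abs_def])
  from fun_calc_tendsto_Icc[OF this]
  have 1: "(\<lambda>n. c *\<^sub>R op_poly id_blinfun (p n) A + d *\<^sub>R op_poly id_blinfun (q n) A)
      \<longlonglongrightarrow> fun_calc (\<lambda>t. c * f t + d * g t) A"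
    by (simp add: op_poly_add op_poly_smult)
  have 2: "(\<lambda>n. c *\<^sub>R op_poly id_blinfun (p n) A + d *\<^sub>R op_poly id_blinfun (q n) A)
      \<longlonglongrightarrow> c *\<^sub>R fun_calc f A + d *\<^sub>R fun_calc g A"
    by (intro tendsto_intros fun_calc_tendsto_Icc p q)
  show ?thesis by (rule LIMSEQ_unique[OF 1 2])
qed

lemma fun_calc_mult:
  assumes f: "continuous_on {a..b} f" and g: "continuous_on {a..b} g"
  shows "fun_calc (\<lambda>t. f t * g t) A = (fun_calc f A o\<^sub>L fun_calc g A)"
proof -
  obtain p where p: "uniform_limit {a..b} (\<lambda>n. poly (p n)) f sequentially"
    using Weierstrass_polynomial_sequence[OF f] .
  obtain q where q: "uniform_limit {a..b} (\<lambda>n. poly (q n)) g sequentially"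
    using Weierstrass_polynomial_sequence[OF g] .
  have "uniform_limit {a..b} (\<lambda>n t. poly (p n) t * poly (q n) t)
      (\<lambda>t. f t * g t) sequentially"
    using compact_imp_bounded[OF compact_continuous_image[OF f compact_Icc]]
      compact_imp_bounded[OF compact_continuous_image[OF g compact_Icc]]
    by (intro uniform_lim_mult p q)
  then have "uniform_limit {a..b} (\<lambda>n. poly (p n * q n)) (\<lambda>t. f t * g t) sequentially"
    by (simp only: poly_mult[abs_def])
  from fun_calc_tendsto_Icc[OF this]
  have 1: "(\<lambda>n. op_poly id_blinfun (p n) A o\<^sub>L op_poly id_blinfun (q n) A)
      \<longlonglongrightarrow> fun_calc (\<lambda>t. f t * g t) A"
    by (simp add: op_poly_mult)
  have 2: "(\<lambda>n. op_poly id_blinfun (p n) A o\<^sub>L op_poly id_blinfun (q n) A)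
      \<longlonglongrightarrow> (fun_calc f A o\<^sub>L fun_calc g A)"
    by (intro bounded_bilinear.tendsto[OF bounded_bilinear_blinfun_compose]
        fun_calc_tendsto_Icc p q)
  show ?thesis by (rule LIMSEQ_unique[OF 1 2])
qed

text \<open>\<open>f(A)\<close> is the square of the self-adjoint operator \<open>(sqrt f)(A)\<close>.\<close>

lemma quad_fun_calc_nonneg:
  assumes f: "continuous_on {a..b} f" and pos: "\<And>t. t \<in> {a..b} \<Longrightarrow> 0 \<le> f t"
  shows "0 \<le> quad (fun_calc f A) x"
proof -
  have s: "continuous_on {a..b} (\<lambda>t. sqrt (f t))" by (intro continuous_intros f)
  have "fun_calc f A = fun_calc (\<lambda>t. sqrt (f t) * sqrt (f t)) A"
    by (rule fun_calc_cong[OF f]) (use pos in simp)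
  also have "\<dots> = (fun_calc (\<lambda>t. sqrt (f t)) A o\<^sub>L fun_calc (\<lambda>t. sqrt (f t)) A)"
    by (rule fun_calc_mult[OF s s])
  finally show ?thesis by (simp add: quad_square self_adjoint_fun_calc[OF s])
qed

lemma quad_fun_calc_mono:
  assumes f: "continuous_on {a..b} f" and g: "continuous_on {a..b} g"
    and le: "\<And>t. t \<in> {a..b} \<Longrightarrow> f t \<le> g t"
  shows "quad (fun_calc f A) x \<le> quad (fun_calc g A) x"
proof -
  have "0 \<le> quad (fun_calc (\<lambda>t. 1 * g t + (-1) * f t) A) x"
    by (rule quad_fun_calc_nonneg) (use le in \<open>auto intro!: continuous_intros f g\<close>)
  then show ?thesis unfolding fun_calc_linear_combination[OF g f] by simp
qed

lemma op_between_fun_calc: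
  assumes f: "continuous_on {a..b} f" and bnd: "\<And>t. t \<in> {a..b} \<Longrightarrow> c \<le> f t \<and> f t \<le> d"
  shows "op_between c d (fun_calc f A)"
  unfolding op_between_def
proof (intro conjI allI)
  fix x
  show "c * (norm x)\<^sup>2 \<le> quad (fun_calc f A) x"
    using quad_fun_calc_mono[of "\<lambda>_. c" f x] f bnd by (simp add: fun_calc_const)
  show "quad (fun_calc f A) x \<le> d * (norm x)\<^sup>2"
    using quad_fun_calc_mono[of f "\<lambda>_. d" x] f bnd by (simp add: fun_calc_const)
qed (rule self_adjoint_fun_calc[OF f])

lemma norm_fun_calc_le:
  assumes f: "continuous_on {a..b} f" and bnd: "\<And>t. t \<in> {a..b} \<Longrightarrow> \<bar>f t\<bar> \<le> c" and c: "0 \<le> c"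
  shows "norm (fun_calc f A) \<le> c"
proof (rule norm_le_of_quad_bound)
  have "op_between (- c) c (fun_calc f A)"
    by (rule op_between_fun_calc[OF f]) (use bnd in fastforce)
  then show "\<bar>quad (fun_calc f A) x\<bar> \<le> c * (norm x)\<^sup>2" for x
    using op_betweenD(2,3)[of "- c" c "fun_calc f A" x] by fastforce
qed (use c self_adjoint_fun_calc[OF f] in auto)

end

lemma fun_calc_scalar:
  fixes f :: "real \<Rightarrow> real"
  shows "fun_calc f (t *\<^sub>R id_blinfun :: 'a::chilbert_space \<Rightarrow>\<^sub>L 'a) = f t *\<^sub>R id_blinfun"
proof -
  have b: "op_between t t (t *\<^sub>R id_blinfun :: 'a \<Rightarrow>\<^sub>L 'a)"
    by (auto simp: op_between_def)
  have "fun_calc f (t *\<^sub>R id_blinfun :: 'a \<Rightarrow>\<^sub>L 'a) = fun_calc (\<lambda>_. f t) (t *\<^sub>R id_blinfun)"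
    by (rule fun_calc_cong[OF b]) auto
  then show ?thesis by (simp add: fun_calc_const[OF b])
qed

text \<open>Uniform polynomial approximation on \<open>{a..b}\<close> approximates \<open>f(F s)\<close> uniformly in \<open>s\<close>, since the error
  is controlled by the supremum on \<open>{a..b}\<close>.\<close>

lemma continuous_on_fun_calc:
  fixes F :: "'t::topological_space \<Rightarrow> 'a::chilbert_space \<Rightarrow>\<^sub>L 'a"
  assumes F: "continuous_on S F" and b: "\<And>s. s \<in> S \<Longrightarrow> op_between a b (F s)"
    and f: "continuous_on {a..b} f"
  shows "continuous_on S (\<lambda>s. fun_calc f (F s))"
proof -
  obtain p where p: "uniform_limit {a..b} (\<lambda>n. poly (p n)) f sequentially"
    using Weierstrass_polynomial_sequence[OF f] .
  have "uniform_limit S (\<lambda>n s. op_poly id_blinfun (p n) (F s)) (\<lambda>s. fun_calc f (F s)) sequentially"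
  proof (rule uniform_limitI)
    fix e :: real assume e: "0 < e"
    have "\<forall>\<^sub>F n in sequentially. \<forall>t\<in>{a..b}. dist (poly (p n) t) (f t) < e / 2"
      using p e by (intro uniform_limitD) auto
    then show "\<forall>\<^sub>F n in sequentially. \<forall>s\<in>S.
        dist (op_poly id_blinfun (p n) (F s)) (fun_calc f (F s)) < e"
    proof (rule eventually_mono)
      fix n assume n: "\<forall>t\<in>{a..b}. dist (poly (p n) t) (f t) < e / 2"
      show "\<forall>s\<in>S. dist (op_poly id_blinfun (p n) (F s)) (fun_calc f (F s)) < e"
      proof
        fix s assume "s \<in> S"
        note bs = b[OF this]
        have c: "continuous_on {a..b} (poly (p n))" by (intro continuous_intros)
        have "norm (fun_calc (\<lambda>t. 1 * poly (p n) t + (-1) * f t) (F s)) \<le> e / 2"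
          by (rule norm_fun_calc_le[OF bs])
             (use n e in \<open>auto intro!: continuous_intros f simp: dist_real_def less_imp_le\<close>)
        then have "dist (op_poly id_blinfun (p n) (F s)) (fun_calc f (F s)) \<le> e / 2"
          unfolding fun_calc_linear_combination[OF bs c f] fun_calc_poly[OF bs]
          by (simp add: dist_norm)
        then show "dist (op_poly id_blinfun (p n) (F s)) (fun_calc f (F s)) < e"
          using e by linarith
      qed
    qed
  qed
  moreover have "\<forall>\<^sub>F n in sequentially. continuous_on S (\<lambda>s. op_poly id_blinfun (p n) (F s))"
    by (intro always_eventually allI continuous_on_op_poly F)
  ultimately show ?thesis
    by (intro uniform_limit_theorem[where F = sequentially]) auto
qed

section \<open>Functional calculus inside a C*-algebra\<close>

lemma cstar_algebraD:
  assumes "cstar_algebra \<A>"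
  shows "\<A> \<subseteq> bounded_ops" "0 \<in> \<A>" "A \<in> \<A> \<Longrightarrow> B \<in> \<A> \<Longrightarrow> A + B \<in> \<A>"
    "A \<in> \<A> \<Longrightarrow> c *\<^sub>C A \<in> \<A>" "A \<in> \<A> \<Longrightarrow> r *\<^sub>R A \<in> \<A>"
    "A \<in> \<A> \<Longrightarrow> B \<in> \<A> \<Longrightarrow> (A o\<^sub>L B) \<in> \<A>" "A \<in> \<A> \<Longrightarrow> B \<in> \<A> \<Longrightarrow> A - B \<in> \<A>" "closed \<A>"
proof -
  show R: "A \<in> \<A> \<Longrightarrow> r *\<^sub>R A \<in> \<A>" for r A
    using assms scaleC_of_real_blinfun[of r A] by (metis cstar_algebra_def)
  show add: "A \<in> \<A> \<Longrightarrow> B \<in> \<A> \<Longrightarrow> A + B \<in> \<A>" for A B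
    using assms by (simp add: cstar_algebra_def)
  show "A \<in> \<A> \<Longrightarrow> B \<in> \<A> \<Longrightarrow> A - B \<in> \<A>"
    using add[of A "(-1) *\<^sub>R B"] R[of B "-1"] by simp
qed (use assms in \<open>auto simp: cstar_algebra_def\<close>)

lemma fun_calc_mem_cstar_algebra:
  assumes alg: "cstar_algebra \<A>" and id: "id_blinfun \<in> \<A>"
    and A: "A \<in> \<A>" "op_between a b A" and f: "continuous_on {a..b} f"
  shows "fun_calc f (A :: 'a::chilbert_space \<Rightarrow>\<^sub>L 'a) \<in> \<A>"
proof -
  obtain p where p: "uniform_limit {a..b} (\<lambda>n. poly (p n)) f sequentially"
    using Weierstrass_polynomial_sequence[OF f] .
  have "op_poly id_blinfun q A \<in> \<A>" for q
    by (induction q) (auto simp: op_poly_pCons intro!: cstar_algebraD[OF alg] id A)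
  then show ?thesis
    by (intro closed_sequentially[OF cstar_algebraD(8)[OF alg] _ fun_calc_tendsto_Icc[OF A(2) p]])
qed

section \<open>Integrals of continuous fields\<close>

lemma lim_1_over_real_Suc: "(\<lambda>n. 1 / real (Suc n)) \<longlonglongrightarrow> 0"
  using LIMSEQ_inverse_real_of_nat by (simp only: inverse_eq_divide)

lemma radon_measureD:
  assumes "radon_measure \<mu>"
  shows "sets \<mu> = sets borel" "space \<mu> = UNIV" "compact K \<Longrightarrow> emeasure \<mu> K < \<infinity>"
    "open U \<Longrightarrow> emeasure \<mu> U = (SUP K\<in>{K. compact K \<and> K \<subseteq> U}. emeasure \<mu> K)"
proof -
  show s: "sets \<mu> = sets borel" using assms by (simp add: radon_measure_def)
  show "space \<mu> = UNIV" using sets_eq_imp_space_eq[OF s] by simp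
qed (use assms in \<open>auto simp: radon_measure_def\<close>)

lemma continuous_borel_measurable_radon:
  fixes g :: "'t::t2_space \<Rightarrow> 'b::topological_space"
  assumes "radon_measure \<mu>" "continuous_on UNIV g"
  shows "g \<in> borel_measurable \<mu>"
  using borel_measurable_continuous_onI[OF assms(2)] radon_measureD(1)[OF assms(1)]
  by (simp cong: measurable_cong_sets)

lemma radon_measure_inner_approx:
  assumes \<mu>: "radon_measure \<mu>" and U: "open U" "emeasure \<mu> U < \<infinity>" and e: "0 < e"
  obtains K where "compact K" "K \<subseteq> U" "measure \<mu> U < measure \<mu> K + e"
proof (rule ccontr)
  note witness = that
  assume no: "\<not> thesis"
  have le: "measure \<mu> K \<le> measure \<mu> U - e" if K: "compact K" "K \<subseteq> U" for K
  proof (rule ccontr)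
    assume "\<not> measure \<mu> K \<le> measure \<mu> U - e"
    then have "measure \<mu> U < measure \<mu> K + e" by simp
    with K no show False by (blast intro: witness)
  qed
  have "emeasure \<mu> K \<le> ennreal (measure \<mu> U - e)" if "compact K" "K \<subseteq> U" for K
    using le[OF that] radon_measureD(3)[OF \<mu> that(1)]
    by (subst emeasure_eq_ennreal_measure) (auto simp: ennreal_leI)
  then have "emeasure \<mu> U \<le> ennreal (measure \<mu> U - e)"
    unfolding radon_measureD(4)[OF \<mu> U(1)] by (auto intro: SUP_least)
  also have "\<dots> < ennreal (measure \<mu> U)"
    using e le[of "{}"] by (intro ennreal_lessI) auto
  also have "\<dots> = emeasure \<mu> U" using U(2) by (subst emeasure_eq_ennreal_measure) auto
  finally show False by simp
qed

text \<open>The integral of \<open>g\<close> is small where \<open>g\<close> is small and where \<open>g\<close> is large; in between \<open>g\<close> is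
  bounded on a set of finite measure, which inner regularity exhausts by compact sets.\<close>

lemma integral_small_off_compact:
  fixes g :: "'t::t2_space \<Rightarrow> real"
  assumes \<mu>: "radon_measure \<mu>" and cont: "continuous_on UNIV g" and pos: "\<And>t. 0 \<le> g t"
    and int: "integrable \<mu> g" and e: "0 < e"
  obtains K where "compact K" "(\<integral>t. g t * indicator (- K) t \<partial>\<mu>) < e"
proof -
  note [measurable] = continuous_borel_measurable_radon[OF \<mu> cont]
  \<comment> \<open>\<open>d n\<close> collects the small part and the large part of \<open>g\<close>; it tends to 0 under the majorant \<open>2 * g\<close>.\<close>
  define d where "d n t = min (g t) (1 / real (Suc n)) + (g t - min (g t) (real (Suc n)))" for n t
  have d_le: "\<bar>d n t\<bar> \<le> 2 * g t" for n t
    using pos[of t] by (auto simp: d_def)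
  have "(\<lambda>n. d n t) \<longlonglongrightarrow> 0" for t
  proof -
    have "(\<lambda>n. min (g t) (1 / real (Suc n))) \<longlonglongrightarrow> min (g t) 0"
      by (intro tendsto_min tendsto_const lim_1_over_real_Suc)
    then have 1: "(\<lambda>n. min (g t) (1 / real (Suc n))) \<longlonglongrightarrow> 0" using pos[of t] by (simp only: min_absorb2)
    obtain N where "g t \<le> real N" using real_arch_simple by blast
    then have "\<forall>\<^sub>F n in sequentially. g t - min (g t) (real (Suc n)) = 0"
      unfolding eventually_sequentially by (intro exI[of _ N]) auto
    then have 2: "(\<lambda>n. g t - min (g t) (real (Suc n))) \<longlonglongrightarrow> 0" by (rule tendsto_eventually)
    show ?thesis using tendsto_add[OF 1 2] by (simp add: d_def)
  qed
  then have "(\<lambda>n. \<integral>t. d n t \<partial>\<mu>) \<longlonglongrightarrow> (\<integral>t. 0 \<partial>\<mu>)"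
    by (intro integral_dominated_convergence[where w = "\<lambda>t. 2 * g t"])
       (use int d_le in \<open>auto simp: d_def\<close>)
  then have "\<forall>\<^sub>F n in sequentially. (\<integral>t. d n t \<partial>\<mu>) < e / 2"
    using e by (intro order_tendstoD(2)) auto
  then obtain n where n: "(\<integral>t. d n t \<partial>\<mu>) < e / 2"
    by (auto simp: eventually_sequentially)
  have dm: "d n \<in> borel_measurable \<mu>" unfolding d_def[abs_def] by measurable
  have int_d: "integrable \<mu> (d n)"
    by (rule Bochner_Integration.integrable_bound[of _ "\<lambda>t. 2 * g t"])
       (use int dm d_le[of n] in \<open>auto intro: order_trans[OF _ abs_ge_self]\<close>)
  define U where "U = {t. 1 / real (Suc n) < g t}"
  have U: "open U" unfolding U_def by (intro open_Collect_less continuous_intros cont)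
  then have [measurable]: "U \<in> sets \<mu>" by (simp add: radon_measureD[OF \<mu>])
  have "integrable \<mu> (indicator U :: 't \<Rightarrow> real)"
  proof (rule Bochner_Integration.integrable_bound[of _ "\<lambda>t. real (Suc n) * g t"])
    show "AE t in \<mu>. norm (indicator U t :: real) \<le> norm (real (Suc n) * g t)"
    proof (intro AE_I2)
      fix t
      show "norm (indicator U t :: real) \<le> norm (real (Suc n) * g t)"
      proof (cases "t \<in> U")
        case True
        then have "1 < g t * real (Suc n)" by (simp only: U_def mem_Collect_eq pos_divide_less_eq of_nat_0_less_iff zero_less_Suc)
        then show ?thesis using True by (simp add: mult.commute)
      qed simp
    qed
  qed (use int in auto)
  then have fin: "emeasure \<mu> U < \<infinity>"
    unfolding integrable_indicator_iff by (simp add: radon_measureD[OF \<mu>])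
  obtain K where K: "compact K" "K \<subseteq> U" "measure \<mu> U < measure \<mu> K + e / (2 * real (Suc n))"
    using radon_measure_inner_approx[OF \<mu> U fin, of "e / (2 * real (Suc n))"] e by auto
  have [measurable]: "K \<in> sets \<mu>"
    using K(1) by (simp add: radon_measureD[OF \<mu>] compact_imp_closed)
  have mUK: "measure \<mu> (U - K) < e / (2 * real (Suc n))"
    using K fin by (subst measure_Diff) auto
  have fin2: "emeasure \<mu> (U - K) < \<infinity>"
    by (rule le_less_trans[OF emeasure_mono fin]) auto
  have "(\<integral>t. g t * indicator (- K) t \<partial>\<mu>) \<le> (\<integral>t. d n t + real (Suc n) * indicator (U - K) t \<partial>\<mu>)"
  proof (rule integral_mono)
    show "integrable \<mu> (\<lambda>t. g t * indicator (- K) t)"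
      by (intro integrable_real_mult_indicator int) (simp add: radon_measureD[OF \<mu>] K(1) compact_imp_closed)
    show "integrable \<mu> (\<lambda>t. d n t + real (Suc n) * indicator (U - K) t)"
      using fin2 int_d by (intro Bochner_Integration.integrable_add) auto
    fix t
    have "g t \<le> d n t + real (Suc n)" using pos[of t] by (auto simp: d_def)
    moreover have "g t \<le> d n t" if "t \<notin> U"
    proof -
      have "g t \<le> 1 / real (Suc n)" using that by (simp add: U_def)
      moreover have "1 / real (Suc n) \<le> real (Suc n)"
        by (rule order_trans[of _ 1]) auto
      ultimately show ?thesis by (simp add: d_def)
    qed
    moreover have "0 \<le> d n t" using pos[of t] by (auto simp: d_def)
    ultimately show "g t * indicator (- K) t \<le> d n t + real (Suc n) * indicator (U - K) t"
      using K(2) by (auto simp: indicator_def)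
  qed
  also have "\<dots> = (\<integral>t. d n t \<partial>\<mu>) + real (Suc n) * measure \<mu> (U - K)"
    using fin2 int_d by (subst Bochner_Integration.integral_add) auto
  also have "\<dots> < e / 2 + real (Suc n) * (e / (2 * real (Suc n)))"
    using n mUK by (intro add_strict_mono mult_strict_left_mono) auto
  also have "\<dots> = e" by (simp add: field_simps del: of_nat_Suc)
  finally show ?thesis using K(1) that by blast
qed

lemma dual_spaceD:
  assumes "cstar_algebra \<A>" and "\<phi> \<in> dual_space \<A>"
  shows "A \<in> \<A> \<Longrightarrow> B \<in> \<A> \<Longrightarrow> \<phi> (A + B) = \<phi> A + \<phi> B"
    "A \<in> \<A> \<Longrightarrow> \<phi> (r *\<^sub>R A) = r *\<^sub>R \<phi> A"
    "A \<in> \<A> \<Longrightarrow> B \<in> \<A> \<Longrightarrow> \<phi> (A - B) = \<phi> A - \<phi> B" "\<phi> 0 = 0"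
proof -
  show add: "A \<in> \<A> \<Longrightarrow> B \<in> \<A> \<Longrightarrow> \<phi> (A + B) = \<phi> A + \<phi> B" for A B
    using assms(2) by (simp add: dual_space_def)
  show R: "A \<in> \<A> \<Longrightarrow> \<phi> (r *\<^sub>R A) = r *\<^sub>R \<phi> A" for r A
    using assms(2) unfolding scaleC_of_real_blinfun[symmetric]
    by (simp add: dual_space_def scaleR_conv_of_real)
  show "A \<in> \<A> \<Longrightarrow> B \<in> \<A> \<Longrightarrow> \<phi> (A - B) = \<phi> A - \<phi> B"
    using add[of A "(-1) *\<^sub>R B"] R[of B "-1"] cstar_algebraD(5)[OF assms(1), of B "-1"] by simp
  show "\<phi> 0 = 0" using R[of 0 0] cstar_algebraD(2)[OF assms(1)] by simp
qed

lemma dual_space_bound: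
  assumes "\<phi> \<in> dual_space \<A>"
  obtains C where "0 \<le> C" "\<And>A. A \<in> \<A> \<Longrightarrow> cmod (\<phi> A) \<le> C * norm A"
proof -
  from assms have "\<exists>C. \<forall>A\<in>\<A>. cmod (\<phi> A) \<le> C * norm A"
    unfolding dual_space_def by simp
  then obtain C where C: "\<And>A. A \<in> \<A> \<Longrightarrow> cmod (\<phi> A) \<le> C * norm A"
    by blast
  have "cmod (\<phi> A) \<le> max 0 C * norm A" if "A \<in> \<A>" for A
    using C[OF that] by (rule order_trans) (intro mult_right_mono, auto)
  then show ?thesis by (intro that[of "max 0 C"]) auto
qed

text \<open>These functionals determine an operator and its norm, so the dual space separates points.\<close>

lemma cinner_mem_dual_space: "(\<lambda>A. cinner (blinfun_apply A x) y) \<in> dual_space \<A>"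
  unfolding dual_space_def
proof (intro CollectI conjI ballI allI exI[of _ "norm x * norm y"])
  fix A
  have "cmod (cinner (blinfun_apply A x) y) \<le> norm (A x) * norm y" by (rule norm_cinner_le)
  also have "\<dots> \<le> norm A * norm x * norm y" by (intro mult_right_mono norm_blinfun) auto
  finally show "cmod (cinner (blinfun_apply A x) y) \<le> norm x * norm y * norm A"
    by (simp add: mult_ac)
qed (simp_all add: blinfun.bilinear_simps cinner.add_left scaleC_blinfun.rep_eq cinner_scaleC_left)

lemma norm_le_of_cinner_bound:
  fixes A :: "'a::complex_inner \<Rightarrow>\<^sub>L 'a"
  assumes b: "\<And>x y. cmod (cinner (A x) y) \<le> c * (norm x * norm y)" and c: "0 \<le> c"
  shows "norm A \<le> c"
proof (rule norm_blinfun_bound[OF c])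
  fix x
  have "norm (A x) * norm (A x) \<le> c * norm x * norm (A x)"
    using b[of x "A x"] by (simp add: cinner_self power2_eq_square norm_mult mult_ac)
  then show "norm (A x) \<le> c * norm x"
    using c by (cases "A x = 0") (simp_all add: mult_le_cancel_right)
qed

context
  fixes \<mu> :: "'t::t2_space measure" and \<A> :: "('a::chilbert_space \<Rightarrow>\<^sub>L 'a) set"
    and F :: "'t \<Rightarrow> 'a \<Rightarrow>\<^sub>L 'a"
  assumes \<mu>: "radon_measure \<mu>" and alg: "cstar_algebra \<A>" and F: "continuous_field \<A> \<mu> F"
begin

lemma field_mem: "F t \<in> \<A>"
  using F by (simp add: continuous_field_def)

lemma integrable_dual_field:
  assumes \<phi>: "\<phi> \<in> dual_space \<A>"
  shows "integrable \<mu> (\<lambda>t. \<phi> (F t))"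
proof -
  obtain C where C: "0 \<le> C" "\<And>A. A \<in> \<A> \<Longrightarrow> cmod (\<phi> A) \<le> C * norm A"
    using dual_space_bound[OF \<phi>] by blast
  have "C-lipschitz_on \<A> \<phi>"
  proof (rule lipschitz_onI)
    fix A B assume "A \<in> \<A>" "B \<in> \<A>"
    then show "dist (\<phi> A) (\<phi> B) \<le> C * dist A B"
      using C(2)[of "A - B"] by (simp add: dist_norm dual_spaceD[OF alg \<phi>] cstar_algebraD[OF alg])
  qed (rule C(1))
  then have "continuous_on \<A> \<phi>" by (rule lipschitz_on_continuous_on)
  then have "continuous_on UNIV (\<lambda>t. \<phi> (F t))"
    by (rule continuous_on_compose2) (use F in \<open>auto simp: continuous_field_def\<close>)
  then have m: "(\<lambda>t. \<phi> (F t)) \<in> borel_measurable \<mu>"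
    by (rule continuous_borel_measurable_radon[OF \<mu>])
  have i: "integrable \<mu> (\<lambda>t. C * norm (F t))"
    using F by (intro integrable_mult_right) (auto simp: continuous_field_def)
  have "norm (\<phi> (F t)) \<le> norm (C * norm (F t))" for t
    using C(2)[OF field_mem, of t] by (rule order_trans) (simp only: real_norm_def abs_ge_self)
  then show ?thesis
    by (intro Bochner_Integration.integrable_bound[OF i m] AE_I2)
qed

text \<open>On a compact set the field is, up to an error \<open>d\<close>, a step function with finitely many values in
  the algebra; off it the integral of the norm is small.  The error is measured through functionals, whose
  composites with the field are continuous complex functions; it is uniform in their bound \<open>C\<close>.\<close>

lemma op_integral_approx:
  assumes e: "0 < e"
  obtains Z where "Z \<in> \<A>"
    "\<And>\<phi> C. \<phi> \<in> dual_space \<A> \<Longrightarrow> 0 \<le> C \<Longrightarrow> (\<And>A. A \<in> \<A> \<Longrightarrow> cmod (\<phi> A) \<le> C * norm A) \<Longrightarrow>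
       cmod (\<phi> Z - (\<integral>t. \<phi> (F t) \<partial>\<mu>)) \<le> C * e"
proof -
  have contF: "continuous_on UNIV F" and intF: "integrable \<mu> (\<lambda>t. norm (F t))"
    using F by (auto simp: continuous_field_def)
  obtain K where K: "compact K" "(\<integral>t. norm (F t) * indicator (- K) t \<partial>\<mu>) < e / 2"
    using integral_small_off_compact[OF \<mu> continuous_on_norm[OF contF] norm_ge_zero intF, of "e / 2"] e
    by auto
  have finK: "emeasure \<mu> K < \<infinity>" using K(1) radon_measureD(3)[OF \<mu>] by blast
  have Km [measurable]: "K \<in> sets \<mu>" "- K \<in> sets \<mu>"
    using K(1) by (simp_all add: radon_measureD[OF \<mu>] compact_imp_closed)
  define d where "d = e / (2 * (measure \<mu> K + 1))"
  have mK: "0 < measure \<mu> K + 1" by (simp add: add_nonneg_pos)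
  have d: "0 < d" using e mK by (simp add: d_def)
  define V where "V t = {s. dist (F s) (F t) < d}" for t
  have V: "open (V t)" for t
    unfolding V_def by (intro open_Collect_less continuous_intros contF)
  have tV: "t \<in> V t" for t using d by (simp add: V_def)
  have "K \<subseteq> (\<Union>t\<in>K. V t)" using tV by blast
  then obtain D where D: "D \<subseteq> K" "finite D" "K \<subseteq> (\<Union>t\<in>D. V t)"
    by (rule compactE_image[OF K(1) V])
  obtain h :: "nat \<Rightarrow> 't" where h: "bij_betw h {0..<card D} D"
    using ex_bij_betw_nat_finite[OF D(2)] by blast
  define N where "N = card D"
  \<comment> \<open>The cover made disjoint, so that exactly one \<open>E i\<close> contains a given point of \<open>K\<close>.\<close>
  define E where "E i = (K \<inter> V (h i)) - (\<Union>j<i. V (h j))" for i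
  have Em [measurable]: "E i \<in> sets \<mu>" for i
    using V K(1) unfolding E_def
    by (intro sets.Diff sets.Int sets.countable_UN'') (auto simp: radon_measureD[OF \<mu>] compact_imp_closed)
  have finE: "emeasure \<mu> (E i) < \<infinity>" for i
    by (rule le_less_trans[OF emeasure_mono finK]) (auto simp: E_def)
  have ex: "\<exists>i<N. t \<in> E i" if tK: "t \<in> K" for t
  proof -
    obtain s where "s \<in> D" "t \<in> V s" using D(3) tK by blast
    moreover from \<open>s \<in> D\<close> h obtain i where "i < N" "s = h i"
      unfolding bij_betw_def N_def by (metis atLeastLessThan_iff imageE)
    ultimately have "i < N \<and> t \<in> V (h i)" by simp
    then have i: "(LEAST i. i < N \<and> t \<in> V (h i)) < N \<and> t \<in> V (h (LEAST i. i < N \<and> t \<in> V (h i)))"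
      by (rule LeastI)
    have "t \<notin> V (h j)" if "j < (LEAST i. i < N \<and> t \<in> V (h i))" for j
      using not_less_Least[OF that] i that by auto
    then show ?thesis using i tK unfolding E_def by blast
  qed
  have uniq: "j = i" if "t \<in> E i" "t \<in> E j" for i j t
    using that by (cases i j rule: linorder_cases) (auto simp: E_def)
  define Z where "Z = (\<Sum>i<N. measure \<mu> (E i) *\<^sub>R F (h i))"
  have Zn: "(\<Sum>i<n. measure \<mu> (E i) *\<^sub>R F (h i)) \<in> \<A>" for n
    by (induction n) (auto intro!: cstar_algebraD[OF alg] field_mem)
  have "cmod (\<phi> Z - (\<integral>t. \<phi> (F t) \<partial>\<mu>)) \<le> C * e"
    if \<phi>: "\<phi> \<in> dual_space \<A>" and C: "0 \<le> C" "\<And>A. A \<in> \<A> \<Longrightarrow> cmod (\<phi> A) \<le> C * norm A" for \<phi> C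
  proof -
    define G where "G t = (\<Sum>i<N. indicator (E i) t *\<^sub>R \<phi> (F (h i)))" for t
    have "\<phi> (\<Sum>i<n. measure \<mu> (E i) *\<^sub>R F (h i)) = (\<Sum>i<n. measure \<mu> (E i) *\<^sub>R \<phi> (F (h i)))" for n
      by (induction n)
         (simp_all add: dual_spaceD[OF alg \<phi>] Zn field_mem cstar_algebraD(5)[OF alg])
    then have \<phi>Z: "\<phi> Z = (\<Sum>i<N. measure \<mu> (E i) *\<^sub>R \<phi> (F (h i)))" by (simp add: Z_def)
    have intE: "integrable \<mu> (\<lambda>t. indicator (E i) t *\<^sub>R \<phi> (F (h i)))" for i
      using finE[of i] by (intro integrable_scaleR_left) (auto intro!: integrable_real_indicator)
    have intG: "integrable \<mu> G" unfolding G_def by (intro Bochner_Integration.integrable_sum intE)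
    have "(\<integral>t. G t \<partial>\<mu>) = (\<Sum>i<N. \<integral>t. indicator (E i) t *\<^sub>R \<phi> (F (h i)) \<partial>\<mu>)"
      unfolding G_def by (rule Bochner_Integration.integral_sum) (rule intE)
    also have "\<dots> = (\<Sum>i<N. measure \<mu> (E i) *\<^sub>R \<phi> (F (h i)))"
    proof (intro sum.cong refl)
      fix i
      have "(\<integral>t. indicator (E i) t *\<^sub>R \<phi> (F (h i)) \<partial>\<mu>)
          = (\<integral>t. indicator (E i) t \<partial>\<mu>) *\<^sub>R \<phi> (F (h i))"
        using finE[of i] by (intro integral_scaleR_left integrable_real_indicator) auto
      then show "(\<integral>t. indicator (E i) t *\<^sub>R \<phi> (F (h i)) \<partial>\<mu>) = measure \<mu> (E i) *\<^sub>R \<phi> (F (h i))"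
        by (simp add: radon_measureD[OF \<mu>])
    qed
    finally have "\<phi> Z - (\<integral>t. \<phi> (F t) \<partial>\<mu>) = (\<integral>t. G t - \<phi> (F t) \<partial>\<mu>)"
      using intG integrable_dual_field[OF \<phi>] by (simp add: \<phi>Z)
    also have "cmod \<dots> \<le> (\<integral>t. cmod (G t - \<phi> (F t)) \<partial>\<mu>)" by (rule integral_norm_bound)
    also have "\<dots> \<le> (\<integral>t. C * d * indicator K t + C * (norm (F t) * indicator (- K) t) \<partial>\<mu>)"
    proof (rule integral_mono)
      show "integrable \<mu> (\<lambda>t. cmod (G t - \<phi> (F t)))"
        using intG integrable_dual_field[OF \<phi>] by auto
      show "integrable \<mu> (\<lambda>t. C * d * indicator K t + C * (norm (F t) * indicator (- K) t))"
        using finK intF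
        by (intro Bochner_Integration.integrable_add integrable_mult_right
            integrable_real_mult_indicator integrable_real_indicator) auto
      fix t
      show "cmod (G t - \<phi> (F t)) \<le> C * d * indicator K t + C * (norm (F t) * indicator (- K) t)"
      proof (cases "t \<in> K")
        case True
        then obtain j where j: "j < N" "t \<in> E j" using ex by blast
        have "G t = (\<Sum>i<N. if i = j then \<phi> (F (h i)) else 0)"
          unfolding G_def using j uniq by (intro sum.cong refl) (auto simp: indicator_def)
        also have "\<dots> = \<phi> (F (h j))" using j by simp
        finally have "cmod (G t - \<phi> (F t)) = cmod (\<phi> (F (h j) - F t))"
          by (simp add: dual_spaceD[OF alg \<phi>] field_mem)
        also have "\<dots> \<le> C * norm (F (h j) - F t)"
          by (intro C(2) cstar_algebraD(7)[OF alg] field_mem)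
        also have "\<dots> \<le> C * d"
          using j(2) C(1) by (intro mult_left_mono) (auto simp: E_def V_def dist_norm norm_minus_commute)
        finally show ?thesis using True by simp
      next
        case False
        then have "G t = 0" by (simp add: G_def E_def)
        then show ?thesis using False C(2)[OF field_mem, of t] by simp
      qed
    qed
    also have "\<dots> = C * d * measure \<mu> K + C * (\<integral>t. norm (F t) * indicator (- K) t \<partial>\<mu>)"
      using finK intF
      by (subst Bochner_Integration.integral_add)
         (auto intro!: integrable_mult_right integrable_real_mult_indicator integrable_real_indicator
           simp: radon_measureD(2)[OF \<mu>])
    also have "\<dots> \<le> C * (e / 2) + C * (e / 2)"
    proof (intro add_mono)
      have "d * measure \<mu> K \<le> d * (measure \<mu> K + 1)" using d by simp
      also have "\<dots> = e / 2" using mK by (simp add: d_def field_simps)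
      finally show "C * d * measure \<mu> K \<le> C * (e / 2)"
        using C(1) by (simp only: mult.assoc mult_left_mono)
      show "C * (\<integral>t. norm (F t) * indicator (- K) t \<partial>\<mu>) \<le> C * (e / 2)"
        by (rule mult_left_mono[OF less_imp_le[OF K(2)] C(1)])
    qed
    finally show ?thesis by simp
  qed
  then show ?thesis using that[of Z] Zn[of N] by (simp add: Z_def)
qed

text \<open>The step approximations form a Cauchy sequence, because \<open>cinner\<close> functionals compute the norm;
  the limit stays in the algebra, which is closed, and has the right value under every functional.\<close>

lemma ex_op_integral: "\<exists>Z\<in>\<A>. \<forall>\<phi>\<in>dual_space \<A>. \<phi> Z = (\<integral>t. \<phi> (F t) \<partial>\<mu>)"
proof -
  have "\<exists>Z. Z \<in> \<A> \<and> (\<forall>\<phi> C. \<phi> \<in> dual_space \<A> \<longrightarrow> 0 \<le> C \<longrightarrow> (\<forall>A\<in>\<A>. cmod (\<phi> A) \<le> C * norm A) \<longrightarrow>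
       cmod (\<phi> Z - (\<integral>t. \<phi> (F t) \<partial>\<mu>)) \<le> C * (1 / real (Suc n)))" for n
    by (rule op_integral_approx[of "1 / real (Suc n)"]) (simp, blast)
  then obtain Z where ZA: "\<And>n. Z n \<in> \<A>" and Z: "\<And>n \<phi> C. \<phi> \<in> dual_space \<A> \<Longrightarrow> 0 \<le> C \<Longrightarrow>
      (\<And>A. A \<in> \<A> \<Longrightarrow> cmod (\<phi> A) \<le> C * norm A) \<Longrightarrow>
       cmod (\<phi> (Z n) - (\<integral>t. \<phi> (F t) \<partial>\<mu>)) \<le> C * (1 / real (Suc n))"
    by metis
  have near: "norm (Z m - Z n) \<le> 1 / real (Suc m) + 1 / real (Suc n)" for m n
  proof (rule norm_le_of_cinner_bound)
    fix x y
    define I where "I = (\<integral>t. cinner (F t x) y \<partial>\<mu>)"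
    have b: "cmod (cinner (Z n x) y - I) \<le> (norm x * norm y) * (1 / real (Suc n))" for n
      unfolding I_def
    proof (rule Z[OF cinner_mem_dual_space])
      fix A
      have "cmod (cinner (blinfun_apply A x) y) \<le> norm (A x) * norm y" by (rule norm_cinner_le)
      also have "\<dots> \<le> norm A * norm x * norm y" by (intro mult_right_mono norm_blinfun) auto
      finally show "cmod (cinner (blinfun_apply A x) y) \<le> norm x * norm y * norm A"
        by (simp add: mult_ac)
    qed simp
    have "cmod (cinner ((Z m - Z n) x) y) = cmod ((cinner (Z m x) y - I) - (cinner (Z n x) y - I))"
      by (simp add: blinfun.bilinear_simps cinner.diff_left)
    also have "\<dots> \<le> cmod (cinner (Z m x) y - I) + cmod (cinner (Z n x) y - I)"
      by (rule norm_triangle_ineq4)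
    also have "\<dots> \<le> (norm x * norm y) * (1 / real (Suc m)) + (norm x * norm y) * (1 / real (Suc n))"
      by (intro add_mono b)
    finally show "cmod (cinner ((Z m - Z n) x) y)
        \<le> (1 / real (Suc m) + 1 / real (Suc n)) * (norm x * norm y)"
      by (simp add: algebra_simps)
  qed simp
  have "Cauchy Z"
  proof (rule CauchyI)
    fix e :: real assume e: "0 < e"
    then obtain N where N: "1 / real (Suc N) < e / 2" using nat_approx_posE[of "e / 2"] by auto
    have "norm (Z m - Z n) < e" if "N \<le> m" "N \<le> n" for m n
    proof -
      have "1 / real (Suc m) \<le> 1 / real (Suc N)" "1 / real (Suc n) \<le> 1 / real (Suc N)"
        using that by (simp_all add: frac_le)
      with near[of m n] N show ?thesis by linarith
    qed
    then show "\<exists>M. \<forall>m\<ge>M. \<forall>n\<ge>M. norm (Z m - Z n) < e" by blast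
  qed
  then obtain Y where Y: "Z \<longlonglongrightarrow> Y" by (auto simp: Cauchy_convergent_iff convergent_def)
  have YA: "Y \<in> \<A>" by (rule closed_sequentially[OF cstar_algebraD(8)[OF alg] ZA Y])
  have "\<phi> Y = (\<integral>t. \<phi> (F t) \<partial>\<mu>)" if \<phi>: "\<phi> \<in> dual_space \<A>" for \<phi>
  proof -
    obtain C where C: "0 \<le> C" "\<And>A. A \<in> \<A> \<Longrightarrow> cmod (\<phi> A) \<le> C * norm A"
      using dual_space_bound[OF \<phi>] by blast
    have "(\<lambda>n. \<phi> (Z n) - (\<integral>t. \<phi> (F t) \<partial>\<mu>)) \<longlonglongrightarrow> 0"
    proof (rule Lim_null_comparison)
      show "\<forall>\<^sub>F n in sequentially. norm (\<phi> (Z n) - (\<integral>t. \<phi> (F t) \<partial>\<mu>)) \<le> C * (1 / real (Suc n))"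
        using Z[OF \<phi> C] by auto
      show "(\<lambda>n. C * (1 / real (Suc n))) \<longlonglongrightarrow> 0"
        by (rule tendsto_mult_right_zero[OF lim_1_over_real_Suc])
    qed
    then have 1: "(\<lambda>n. \<phi> (Z n)) \<longlonglongrightarrow> (\<integral>t. \<phi> (F t) \<partial>\<mu>)" by (simp add: LIM_zero_iff)
    have "(\<lambda>n. \<phi> (Z n) - \<phi> Y) \<longlonglongrightarrow> 0"
    proof (rule Lim_null_comparison)
      show "\<forall>\<^sub>F n in sequentially. norm (\<phi> (Z n) - \<phi> Y) \<le> C * norm (Z n - Y)"
        using C(2)[OF cstar_algebraD(7)[OF alg ZA YA]]
        by (simp add: dual_spaceD[OF alg \<phi>] ZA YA)
      show "(\<lambda>n. C * norm (Z n - Y)) \<longlonglongrightarrow> 0"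
        by (rule tendsto_mult_right_zero[OF tendsto_norm_zero[OF LIM_zero[OF Y]]])
    qed
    then have 2: "(\<lambda>n. \<phi> (Z n)) \<longlonglongrightarrow> \<phi> Y" by (simp add: LIM_zero_iff)
    show ?thesis by (rule LIMSEQ_unique[OF 2 1])
  qed
  with YA show ?thesis by blast
qed

text \<open>Existence makes the definite description meaningful; uniqueness comes from the functionals
  \<open>cinner\<close>.\<close>

lemma op_integral_mem_dual:
  "op_integral \<A> \<mu> F \<in> \<A> \<and> (\<forall>\<phi>\<in>dual_space \<A>. \<phi> (op_integral \<A> \<mu> F) = (\<integral>t. \<phi> (F t) \<partial>\<mu>))"
proof -
  obtain Z where Z: "Z \<in> \<A> \<and> (\<forall>\<phi>\<in>dual_space \<A>. \<phi> Z = (\<integral>t. \<phi> (F t) \<partial>\<mu>))"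
    using ex_op_integral by blast
  show ?thesis unfolding op_integral_def
  proof (rule theI[where P = "\<lambda>Z. Z \<in> \<A> \<and> (\<forall>\<phi>\<in>dual_space \<A>. \<phi> Z = (\<integral>t. \<phi> (F t) \<partial>\<mu>))", OF Z])
    fix Y assume Y: "Y \<in> \<A> \<and> (\<forall>\<phi>\<in>dual_space \<A>. \<phi> Y = (\<integral>t. \<phi> (F t) \<partial>\<mu>))"
    have "cinner (Y x) y = cinner (Z x) y" for x y
      using bspec[OF conjunct2[OF Y] cinner_mem_dual_space[of x y \<A>]]
        bspec[OF conjunct2[OF Z] cinner_mem_dual_space[of x y \<A>]] by simp
    then show "Y = Z" by (intro blinfun_eqI eq_if_cinner_eq)
  qed
qed

lemma op_integral_mem: "op_integral \<A> \<mu> F \<in> \<A>"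
  using op_integral_mem_dual by blast

lemma cinner_op_integral: "cinner (op_integral \<A> \<mu> F x) y = (\<integral>t. cinner (F t x) y \<partial>\<mu>)"
  using bspec[OF conjunct2[OF op_integral_mem_dual] cinner_mem_dual_space[of x y \<A>]] by simp

lemma integrable_cinner_field: "integrable \<mu> (\<lambda>t. cinner (F t x) y)"
  by (rule integrable_dual_field[OF cinner_mem_dual_space])

lemma quad_op_integral: "quad (op_integral \<A> \<mu> F) x = (\<integral>t. quad (F t) x \<partial>\<mu>)"
  unfolding quad_def cinner_op_integral by (rule integral_Re[symmetric, OF integrable_cinner_field])

lemma integrable_quad_field: "integrable \<mu> (\<lambda>t. quad (F t) x)"
  unfolding quad_def by (intro integrable_Re integrable_cinner_field)

lemma self_adjoint_op_integral:
  assumes "\<And>t. self_adjoint (F t)"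
  shows "self_adjoint (op_integral \<A> \<mu> F)"
proof (rule self_adjointI)
  show "op_integral \<A> \<mu> F \<in> bounded_ops" using op_integral_mem cstar_algebraD(1)[OF alg] by blast
  fix x y
  have "cinner x (op_integral \<A> \<mu> F y) = cnj (cinner (op_integral \<A> \<mu> F y) x)"
    by (rule cinner_commute)
  also have "\<dots> = (\<integral>t. cnj (cinner (F t y) x) \<partial>\<mu>)"
    unfolding cinner_op_integral by simp
  also have "\<dots> = (\<integral>t. cinner (F t x) y \<partial>\<mu>)"
    by (intro Bochner_Integration.integral_cong refl)
       (metis assms cinner_commute self_adjointD(1))
  finally show "cinner (op_integral \<A> \<mu> F x) y = cinner x (op_integral \<A> \<mu> F y)"
    by (simp add: cinner_op_integral)
qed

end

section \<open>Concave functions and their chords\<close>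

text \<open>This verifies the spectral hypothesis of operator concavity for multiples of the identity.\<close>

lemma op_spectrum_scalar:
  "op_spectrum id_blinfun (x *\<^sub>R id_blinfun :: 'a::complex_inner \<Rightarrow>\<^sub>L 'a) \<subseteq> {complex_of_real x}"
proof (intro subsetI, rule ccontr)
  fix z assume z: "z \<in> op_spectrum id_blinfun (x *\<^sub>R id_blinfun :: 'a \<Rightarrow>\<^sub>L 'a)" "z \<notin> {complex_of_real x}"
  define c where "c = complex_of_real x - z"
  have c: "c \<noteq> 0" using z(2) by (simp add: c_def)
  define B :: "'a \<Rightarrow>\<^sub>L 'a" where "B = (1 / c) *\<^sub>C id_blinfun"
  have B: "B v = (1 / c) *\<^sub>C v" for v by (simp add: B_def scaleC_blinfun.rep_eq)
  have one: "1 *\<^sub>C v = v" for v :: 'a using scaleR_scaleC[of 1 v] by simp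
  have D: "(x *\<^sub>R id_blinfun - z *\<^sub>C id_blinfun :: 'a \<Rightarrow>\<^sub>L 'a) v = c *\<^sub>C v" for v
  proof -
    have "c *\<^sub>C v + z *\<^sub>C v = x *\<^sub>R v"
      by (simp add: scaleC_add_left[symmetric] c_def scaleR_scaleC)
    then show ?thesis
      by (simp add: blinfun.bilinear_simps scaleC_blinfun.rep_eq algebra_simps)
  qed
  have "B \<in> ops_on id_blinfun"
    by (simp add: ops_on_def bounded_ops_def B scaleC_scaleC mult.commute)
  moreover have "(x *\<^sub>R id_blinfun - z *\<^sub>C id_blinfun) o\<^sub>L B = id_blinfun"
    "B o\<^sub>L (x *\<^sub>R id_blinfun - z *\<^sub>C id_blinfun) = id_blinfun"
    by (rule blinfun_eqI, simp add: D B scaleC_scaleC c one)+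
  ultimately show False using z(1) by (auto simp: op_spectrum_def)
qed

lemma ex_nonzero_ell2: "\<exists>v :: 'i ell2. v \<noteq> 0"
proof -
  define x :: "'i \<Rightarrow> complex" where "x = (\<lambda>i. if i = undefined then 1 else 0)"
  have "(\<lambda>i. (cmod (x i))\<^sup>2) summable_on {undefined}" by simp
  then have "(\<lambda>i. (cmod (x i))\<^sup>2) summable_on UNIV"
    by (rule summable_on_cong_neutral[THEN iffD1, rotated -1]) (auto simp: x_def)
  then have "ell2_apply (Abs_ell2 x) = x" by (intro Abs_ell2_inverse) simp
  moreover have "x undefined \<noteq> 0" by (simp add: x_def)
  ultimately have "Abs_ell2 x \<noteq> 0" by (metis zero_ell2.rep_eq)
  then show ?thesis by blast
qed

text \<open>Restricting operator concavity to multiples of the identity leaves concavity of \<open>f\<close>, as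
  one sees by evaluating the forms at a nonzero vector.\<close>

lemma concave_on_if_operator_concave:
  assumes "operator_concave TYPE('i) J f" and J: "convex J"
  shows "concave_on J f"
  unfolding concave_on_iff
proof (intro conjI ballI allI impI J)
  fix x y u v :: real assume xy: "x \<in> J" "y \<in> J" and uv: "0 \<le> u" "0 \<le> v" "u + v = 1"
  let ?I = "id_blinfun :: 'i ell2 \<Rightarrow>\<^sub>L 'i ell2"
  have I: "orth_projection ?I" by (simp add: orth_projection_def)
  have mem: "r *\<^sub>R ?I \<in> ops_on ?I" for r by (simp add: ops_on_def)
  have spec: "op_spectrum ?I (r *\<^sub>R ?I) \<subseteq> complex_of_real ` J" if "r \<in> J" for r
    using op_spectrum_scalar[of r] that by blast
  have v: "v = 1 - u" using uv by simp
  have "u \<in> {0..1}" using uv by simp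
  then have "u *\<^sub>R fun_calc f (x *\<^sub>R ?I) + (1 - u) *\<^sub>R fun_calc f (y *\<^sub>R ?I)
      \<preceq> fun_calc f (u *\<^sub>R (x *\<^sub>R ?I) + (1 - u) *\<^sub>R (y *\<^sub>R ?I))"
    using assms(1) I mem spec[OF xy(1)] spec[OF xy(2)]
    unfolding operator_concave_def by (metis self_adjoint_simps(1,5))
  moreover have "u *\<^sub>R (x *\<^sub>R ?I) + (1 - u) *\<^sub>R (y *\<^sub>R ?I) = (u * x + v * y) *\<^sub>R ?I"
    by (simp add: v algebra_simps)
  ultimately have le: "u *\<^sub>R (f x *\<^sub>R ?I) + v *\<^sub>R (f y *\<^sub>R ?I) \<preceq> f (u * x + v * y) *\<^sub>R ?I"
    by (simp only: fun_calc_scalar v)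
  obtain w :: "'i ell2" where w: "w \<noteq> 0" using ex_nonzero_ell2 by blast
  have "(u * f x + v * f y) * (norm w)\<^sup>2 \<le> f (u * x + v * y) * (norm w)\<^sup>2"
    using le[unfolded loewner_le_iff_quad] by (simp add: algebra_simps)
  then have "u * f x + v * f y \<le> f (u * x + v * y)"
    by (rule mult_right_le_imp_le) (use w in simp)
  then show "u * f x + v * f y \<le> f (u *\<^sub>R x + v *\<^sub>R y)" by simp
qed

text \<open>Every \<open>t > 0\<close> is a proper convex combination of a point where \<open>f > 0\<close> and another point of the
  half-line, where \<open>f \<ge> 0\<close>.\<close>

lemma concave_nonneg_pos:
  fixes f :: "real \<Rightarrow> real"
  assumes f: "concave_on {0<..} f" and nonneg: "\<And>t. 0 < t \<Longrightarrow> 0 \<le> f t"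
    and ex: "\<exists>t>0. f t \<noteq> 0" and t: "0 < t"
  shows "0 < f t"
proof -
  obtain r where r: "0 < r" "f r \<noteq> 0" using ex by blast
  have fr: "0 < f r" using nonneg[OF r(1)] r(2) by linarith
  have comb: "0 < f (u * s + v * r)" if "0 < s" "0 \<le> u" "0 < v" "u + v = 1" for s u v
  proof -
    have "u * f s + v * f r \<le> f (u * s + v * r)"
      using f that r(1) unfolding concave_on_iff by auto
    moreover have "0 \<le> u * f s" "0 < v * f r" using that fr nonneg[OF that(1)] by simp_all
    ultimately show ?thesis by linarith
  qed
  show ?thesis
  proof (cases "t < r")
    case True
    \<comment> \<open>The combination is \<open>t = (1 - v) * (t / 2) + v * r\<close>.\<close>
    define d where "d = r - t / 2"
    define v where "v = (t / 2) / d"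
    have "t / 2 < d" using True by (simp add: d_def)
    then have v: "0 < v" "v \<le> 1" "v * d = t / 2"
      using t by (simp_all add: v_def)
    have "0 < f ((1 - v) * (t / 2) + v * r)" (is "0 < f ?c")
      by (rule comb) (use v t in auto)
    also have "?c = t / 2 + v * d"
      by (simp only: d_def left_diff_distrib right_diff_distrib)
    also have "\<dots> = t" by (simp add: v(3))
    finally show ?thesis .
  next
    case False
    \<comment> \<open>Here \<open>t\<close> is the midpoint of \<open>r\<close> and its reflection at \<open>t\<close>.\<close>
    have "0 < f (1 / 2 * (2 * t - r) + 1 / 2 * r)"
      by (rule comb) (use False t in auto)
    moreover have "1 / 2 * (2 * t - r) + 1 / 2 * r = t" by (simp add: field_simps)
    ultimately show ?thesis by (simp only:)
  qed
qed

context
  fixes f :: "real \<Rightarrow> real" and m M :: real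
  assumes f: "concave_on {m..M} f" and cont: "continuous_on {m..M} f"
    and pos: "\<And>t. t \<in> {m..M} \<Longrightarrow> 0 < f t" and mM: "m < M"
begin

text \<open>The chord is a convex combination of the endpoint values \<open>f m\<close> and \<open>f M\<close>, and concavity puts it
  below the graph.\<close>

lemma chord_between:
  assumes t: "t \<in> {m..M}"
  shows "0 < chord_slope f m M * t + chord_intercept f m M"
    and "chord_slope f m M * t + chord_intercept f m M \<le> f t"
proof -
  define v where "v = (t - m) / (M - m)"
  have v: "0 \<le> v" "v \<le> 1" using t mM by (simp_all add: v_def)
  have "v * (M - m) = t - m" using mM by (simp add: v_def)
  then have tv: "(1 - v) * m + v * M = t" by (simp add: algebra_simps)
  have c: "chord_slope f m M * (M - m) = f M - f m"
    "chord_intercept f m M * (M - m) = M * f m - m * f M"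
    using mM by (simp_all add: chord_slope_def chord_intercept_def)
  have "(chord_slope f m M * m + chord_intercept f m M) * (M - m)
      = (chord_slope f m M * (M - m)) * m + chord_intercept f m M * (M - m)"
    by (simp add: algebra_simps)
  also have "\<dots> = f m * (M - m)" unfolding c by (simp add: algebra_simps)
  finally have ends1: "chord_slope f m M * m + chord_intercept f m M = f m"
    using mM by simp
  have "(chord_slope f m M * M + chord_intercept f m M) * (M - m)
      = (chord_slope f m M * (M - m)) * M + chord_intercept f m M * (M - m)"
    by (simp add: algebra_simps)
  also have "\<dots> = f M * (M - m)" unfolding c by (simp add: algebra_simps)
  finally have ends2: "chord_slope f m M * M + chord_intercept f m M = f M"
    using mM by simp
  note ends = ends1 ends2
  have "chord_slope f m M * t + chord_intercept f m M
      = (chord_slope f m M * m + chord_intercept f m M) * (1 - v)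
        + (chord_slope f m M * M + chord_intercept f m M) * v"
    unfolding tv[symmetric] by (simp add: algebra_simps)
  also have "\<dots> = (1 - v) * f m + v * f M"
    unfolding ends by (simp add: mult.commute)
  finally have L: "chord_slope f m M * t + chord_intercept f m M = (1 - v) * f m + v * f M" .
  have "(1 - v) * f m + v * f M \<le> f ((1 - v) * m + v * M)"
    using f v mM unfolding concave_on_iff by auto
  then show "chord_slope f m M * t + chord_intercept f m M \<le> f t"
    by (simp add: L tv)
  have fm: "0 < f m" "0 < f M" using pos mM by auto
  have "min (f m) (f M) = (1 - v) * min (f m) (f M) + v * min (f m) (f M)"
    by (simp add: algebra_simps)
  also have "\<dots> \<le> (1 - v) * f m + v * f M"
    using v by (intro add_mono mult_left_mono) auto
  finally show "0 < chord_slope f m M * t + chord_intercept f m M"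
    using fm L by linarith
qed

text \<open>The quotient is continuous on a compact interval, so \<^const>\<open>Greatest\<close> is an attained maximum.\<close>

lemma chord_ratio_max_bound:
  shows "0 < chord_ratio_max f m M"
    and "t \<in> {m..M} \<Longrightarrow>
      f t \<le> chord_ratio_max f m M * (chord_slope f m M * t + chord_intercept f m M)"
proof -
  define g where "g t = f t / (chord_slope f m M * t + chord_intercept f m M)" for t
  have "continuous_on {m..M} g"
    unfolding g_def using chord_between(1) by (intro continuous_intros cont) force
  then obtain t0 where t0: "t0 \<in> {m..M}" "\<And>t. t \<in> {m..M} \<Longrightarrow> g t \<le> g t0"
    using continuous_attains_sup[OF compact_Icc, of m M g] mM by auto
  have eq: "chord_ratio_max f m M = g t0"
    unfolding chord_ratio_max_def g_def[symmetric]
    by (rule Greatest_equality) (use t0 in auto)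
  show "0 < chord_ratio_max f m M"
    unfolding eq g_def using pos[OF t0(1)] chord_between(1)[OF t0(1)] by simp
  assume t: "t \<in> {m..M}"
  show "f t \<le> chord_ratio_max f m M * (chord_slope f m M * t + chord_intercept f m M)"
    using t0(2)[OF t] chord_between(1)[OF t] unfolding eq by (simp add: g_def pos_divide_le_eq)
qed

end

section \<open>Powers of strictly positive operators\<close>

lemma strictly_positive_op_between:
  assumes "strictly_positive A"
  obtains a b where "0 < a" "op_between a b A"
proof -
  have A: "self_adjoint A" "\<And>x. 0 \<le> quad A x" "op_unit A"
    using assms by (auto simp: strictly_positive_def loewner_le_iff_quad op_unit_def)
  obtain a where a: "0 < a" "\<And>x. a * (norm x)\<^sup>2 \<le> quad A x"
    using quad_ge_if_op_unit[OF A] by blast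
  have "quad A x \<le> norm A * (norm x)\<^sup>2" for x using abs_quad_le[of A x] by linarith
  then have "op_between a (norm A) A" using A a by (simp add: op_between_def)
  then show ?thesis using a(1) that by blast
qed

lemma continuous_on_powr_Icc:
  assumes "0 < (a :: real)"
  shows "continuous_on {a..b} (\<lambda>t. t powr q)"
  using assms by (intro continuous_intros) auto

lemma op_powr_add:
  fixes A :: "'a::chilbert_space \<Rightarrow>\<^sub>L 'a"
  assumes a: "0 < a" and A: "op_between a b A"
  shows "(op_powr A q o\<^sub>L op_powr A r) = op_powr A (q + r)"
proof -
  have "fun_calc (\<lambda>t. t powr (q + r)) A = fun_calc (\<lambda>t. t powr q * t powr r) A"
    by (simp add: powr_add)
  then show ?thesis
    unfolding op_powr_def
    by (simp add: fun_calc_mult[OF A continuous_on_powr_Icc[OF a] continuous_on_powr_Icc[OF a]])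
qed

lemma op_powr_0:
  fixes A :: "'a::chilbert_space \<Rightarrow>\<^sub>L 'a"
  assumes a: "0 < a" and A: "op_between a b A"
  shows "op_powr A 0 = id_blinfun"
proof -
  have "op_powr A 0 = fun_calc (\<lambda>_. 1) A"
    unfolding op_powr_def by (rule fun_calc_cong[OF A continuous_on_powr_Icc[OF a]]) (use a in auto)
  then show ?thesis by (simp add: fun_calc_const[OF A])
qed

lemma op_powr_1:
  fixes A :: "'a::chilbert_space \<Rightarrow>\<^sub>L 'a"
  assumes a: "0 < a" and A: "op_between a b A"
  shows "op_powr A 1 = A"
proof -
  have "op_powr A 1 = fun_calc (\<lambda>t. t) A"
    unfolding op_powr_def by (rule fun_calc_cong[OF A continuous_on_powr_Icc[OF a]]) (use a in auto)
  then show ?thesis by (simp add: fun_calc_id[OF A])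
qed

lemma self_adjoint_op_powr:
  fixes A :: "'a::chilbert_space \<Rightarrow>\<^sub>L 'a"
  assumes a: "0 < a" and A: "op_between a b A"
  shows "self_adjoint (op_powr A q)"
  unfolding op_powr_def by (rule self_adjoint_fun_calc[OF A continuous_on_powr_Icc[OF a]])

lemma op_powr_mem_cstar_algebra:
  fixes A :: "'a::chilbert_space \<Rightarrow>\<^sub>L 'a"
  assumes "cstar_algebra \<A>" "id_blinfun \<in> \<A>" "A \<in> \<A>" "0 < a" "op_between a b A"
  shows "op_powr A q \<in> \<A>"
  unfolding op_powr_def
  by (rule fun_calc_mem_cstar_algebra[OF assms(1-3,5) continuous_on_powr_Icc[OF assms(4)]])

text \<open>Strict positivity persists near a point with uniform bounds, which makes \<open>t powr q\<close> continuous on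
  one interval that serves a whole neighbourhood.\<close>

lemma continuous_on_op_powr:
  fixes A :: "'t::t2_space \<Rightarrow> 'a::chilbert_space \<Rightarrow>\<^sub>L 'a"
  assumes A: "continuous_on UNIV A" and pos: "\<And>s. strictly_positive (A s)"
  shows "continuous_on UNIV (\<lambda>s. op_powr (A s) q)"
proof -
  have "isCont (\<lambda>s. op_powr (A s) q) s0" for s0
  proof -
    obtain a b where a: "0 < a" "op_between a b (A s0)"
      using strictly_positive_op_between[OF pos] by blast
    define U where "U = {s. norm (A s - A s0) < a / 2}"
    have U: "open U" unfolding U_def by (intro open_Collect_less continuous_intros A)
    have "s0 \<in> U" using a(1) by (simp add: U_def)
    have "op_between (a / 2) (b + a / 2) (A s)" if "s \<in> U" for s
      unfolding op_between_def
    proof (intro conjI allI)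
      show "self_adjoint (A s)"
        using pos[of s] by (auto simp: strictly_positive_def loewner_le_iff_quad)
      fix x
      have "\<bar>quad (A s - A s0) x\<bar> \<le> a / 2 * (norm x)\<^sup>2"
        using abs_quad_le[of "A s - A s0" x] that mult_right_mono[of "norm (A s - A s0)" "a / 2" "(norm x)\<^sup>2"]
        by (simp add: U_def)
      then show "a / 2 * (norm x)\<^sup>2 \<le> quad (A s) x" "quad (A s) x \<le> (b + a / 2) * (norm x)\<^sup>2"
        using op_betweenD(2,3)[OF a(2), of x] unfolding abs_le_iff quad_simps distrib_right
        by linarith+
    qed
    then have "continuous_on U (\<lambda>s. op_powr (A s) q)"
      unfolding op_powr_def
      using a(1) by (intro continuous_on_fun_calc[where a = "a / 2" and b = "b + a / 2"]
          continuous_on_subset[OF A] continuous_on_powr_Icc) auto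
    then show ?thesis using U \<open>s0 \<in> U\<close> by (simp add: continuous_on_eq_continuous_at)
  qed
  then show ?thesis by (simp add: continuous_on_eq_continuous_at)
qed

section \<open>Operator perspectives\<close>

text \<open>The noncommutative analogue of \<open>Y / X\<close>.\<close>

definition op_quotient :: "('a::complex_inner \<Rightarrow>\<^sub>L 'a) \<Rightarrow> ('a \<Rightarrow>\<^sub>L 'a) \<Rightarrow> ('a \<Rightarrow>\<^sub>L 'a)" where
  "op_quotient X Y = op_powr X (-1/2) o\<^sub>L Y o\<^sub>L op_powr X (-1/2)"

text \<open>The noncommutative perspective \<open>X * g (Y / X)\<close> of \<open>g\<close>.  The means, the entropies and the operators
  \<open>X\<close> and \<open>Y\<close> themselves are all perspectives, so that inequalities and identities between them reduce to
  those between the functions \<open>g\<close>.\<close>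

definition op_perspective ::
    "(real \<Rightarrow> real) \<Rightarrow> ('a::complex_inner \<Rightarrow>\<^sub>L 'a) \<Rightarrow> ('a \<Rightarrow>\<^sub>L 'a) \<Rightarrow> ('a \<Rightarrow>\<^sub>L 'a)" where
  "op_perspective g X Y = op_powr X (1/2) o\<^sub>L fun_calc g (op_quotient X Y) o\<^sub>L op_powr X (1/2)"

lemma natural_mean_eq_perspective: "natural_mean q X Y = op_perspective (\<lambda>t. t powr q) X Y"
  by (simp add: natural_mean_def op_perspective_def op_quotient_def op_powr_def)

context
  fixes X Y :: "'a::chilbert_space \<Rightarrow>\<^sub>L 'a" and m M :: real
  assumes X: "strictly_positive X" and le: "m *\<^sub>R X \<preceq> Y" "Y \<preceq> M *\<^sub>R X"
begin

lemma sqrt_cancel: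
  "op_powr X (1/2) o\<^sub>L op_powr X (-1/2) = id_blinfun"
  "op_powr X (-1/2) o\<^sub>L op_powr X (1/2) = id_blinfun"
  "op_powr X (1/2) o\<^sub>L op_powr X (1/2) = X"
  "op_powr X (-1/2) o\<^sub>L X o\<^sub>L op_powr X (-1/2) = id_blinfun"
  "self_adjoint (op_powr X q)"
proof -
  obtain a b where ab: "0 < a" "op_between a b X"
    using strictly_positive_op_between[OF X] .
  note add = op_powr_add[OF ab] and p0 = op_powr_0[OF ab] and p1 = op_powr_1[OF ab]
  show 1: "op_powr X (1/2) o\<^sub>L op_powr X (-1/2) = id_blinfun"
    "op_powr X (-1/2) o\<^sub>L op_powr X (1/2) = id_blinfun"
    "op_powr X (1/2) o\<^sub>L op_powr X (1/2) = X"
    by (simp_all add: add p0 p1)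
  have "op_powr X (-1/2) o\<^sub>L X o\<^sub>L op_powr X (-1/2)
      = (op_powr X (-1/2) o\<^sub>L op_powr X (1/2)) o\<^sub>L (op_powr X (1/2) o\<^sub>L op_powr X (-1/2))"
    by (simp only: compose_assoc) (simp only: compose_assoc[symmetric] 1(3))
  then show "op_powr X (-1/2) o\<^sub>L X o\<^sub>L op_powr X (-1/2) = id_blinfun"
    by (simp only: 1 id_compose)
  show "self_adjoint (op_powr X q)" by (rule self_adjoint_op_powr[OF ab])
qed

lemma op_between_op_quotient: "op_between m M (op_quotient X Y)"
proof -
  let ?h = "op_powr X (-1/2)"
  have Y: "self_adjoint Y" "\<And>x. m * quad X x \<le> quad Y x" "\<And>x. quad Y x \<le> M * quad X x"
    using le by (auto simp: loewner_le_iff_quad)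
  have h: "self_adjoint ?h" by (rule sqrt_cancel)
  have "quad X (?h x) = (norm x)\<^sup>2" for x
    using quad_sandwich[OF h, of X x] by (simp only: sqrt_cancel(4) quad_simps)
  then have "m * (norm x)\<^sup>2 \<le> quad Y (?h x)" "quad Y (?h x) \<le> M * (norm x)\<^sup>2" for x
    using Y(2)[of "?h x"] Y(3)[of "?h x"] by simp_all
  then show ?thesis
    unfolding op_between_def op_quotient_def quad_sandwich[OF h]
    using self_adjoint_sandwich[OF h Y(1)] by blast
qed

lemma self_adjoint_op_perspective:
  assumes "continuous_on {m..M} g"
  shows "self_adjoint (op_perspective g X Y)"
  unfolding op_perspective_def
  by (intro self_adjoint_sandwich sqrt_cancel self_adjoint_fun_calc[OF op_between_op_quotient assms])

lemma quad_op_perspective: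
  "quad (op_perspective g X Y) x = quad (fun_calc g (op_quotient X Y)) (op_powr X (1/2) x)"
  unfolding op_perspective_def by (rule quad_sandwich) (rule sqrt_cancel)

lemma op_perspective_1: "op_perspective (\<lambda>_. 1) X Y = X"
  unfolding op_perspective_def fun_calc_const[OF op_between_op_quotient]
  by (simp only: scaleR_one id_compose sqrt_cancel)

lemma op_perspective_id: "op_perspective (\<lambda>t. t) X Y = Y"
proof -
  have "op_perspective (\<lambda>t. t) X Y
      = (op_powr X (1/2) o\<^sub>L op_powr X (-1/2)) o\<^sub>L Y o\<^sub>L (op_powr X (-1/2) o\<^sub>L op_powr X (1/2))"
    unfolding op_perspective_def fun_calc_id[OF op_between_op_quotient]
    by (simp only: op_quotient_def compose_assoc)
  then show ?thesis by (simp only: sqrt_cancel id_compose)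
qed

text \<open>Uses that \<open>norm (X powr (1/2))\<close> squared is at most \<open>norm X\<close>; the bound transports integrability from
  the field of the \<open>X\<close> to that of the perspectives.\<close>

lemma norm_op_perspective_le:
  assumes g: "continuous_on {m..M} g" and c: "\<And>t. t \<in> {m..M} \<Longrightarrow> \<bar>g t\<bar> \<le> c" "0 \<le> c"
  shows "norm (op_perspective g X Y) \<le> c * norm X"
proof -
  let ?h = "op_powr X (1/2)"
  have "norm ?h \<le> sqrt (norm X)"
  proof (rule norm_blinfun_bound)
    fix x
    have "(norm (?h x))\<^sup>2 = quad X x"
      using quad_square[of ?h x] by (simp only: sqrt_cancel)
    also have "\<dots> \<le> norm X * (norm x)\<^sup>2" using abs_quad_le[of X x] by linarith
    also have "\<dots> = (sqrt (norm X) * norm x)\<^sup>2" by (simp add: power_mult_distrib)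
    finally show "norm (?h x) \<le> sqrt (norm X) * norm x" by (rule power2_le_imp_le) simp
  qed simp
  moreover have "norm (fun_calc g (op_quotient X Y)) \<le> c"
    by (rule norm_fun_calc_le[OF op_between_op_quotient g c])
  moreover have "norm (op_perspective g X Y) \<le> norm ?h * norm (fun_calc g (op_quotient X Y)) * norm ?h"
    unfolding op_perspective_def
    by (rule order_trans[OF norm_blinfun_compose mult_right_mono[OF norm_blinfun_compose]]) simp
  moreover have "norm ?h * norm (fun_calc g (op_quotient X Y)) * norm ?h
      \<le> sqrt (norm X) * c * sqrt (norm X)"
    using calculation c(2) by (intro mult_mono) auto
  ultimately show ?thesis by (simp add: mult_ac)
qed

lemma rel_entropy_eq_perspective:
  assumes m: "0 < m" and f: "continuous_on {m..M} f"
  shows "rel_entropy q f X Y = op_perspective (\<lambda>t. t powr q * f t) X Y"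
  unfolding rel_entropy_def op_quotient_def[symmetric] Let_def
  unfolding op_perspective_def op_powr_def[of "op_quotient X Y"]
    fun_calc_mult[OF op_between_op_quotient continuous_on_powr_Icc[OF m] f]
  by (simp only: compose_assoc)

end

section \<open>The positive linear map of a pair of fields\<close>

context
  fixes \<mu> :: "'t::t2_space measure" and \<A> :: "('a::chilbert_space \<Rightarrow>\<^sub>L 'a) set"
    and A B :: "'t \<Rightarrow> 'a \<Rightarrow>\<^sub>L 'a" and m M :: real
  assumes \<mu>: "radon_measure \<mu>" and alg: "cstar_algebra \<A>"
    and A: "continuous_field \<A> \<mu> A" and B: "continuous_field \<A> \<mu> B"
    and posA: "\<And>s. strictly_positive (A s)"
    and mAB: "\<And>s. m *\<^sub>R A s \<preceq> B s" and ABM: "\<And>s. B s \<preceq> M *\<^sub>R A s"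
    and intA: "op_integral \<A> \<mu> A = id_blinfun"
begin

text \<open>The constant term of a polynomial brings the identity into the functional calculus; the algebra
  contains the identity, because it contains the integral of a field.\<close>

lemma id_mem: "id_blinfun \<in> \<A>"
  using op_integral_mem[OF \<mu> alg A] by (simp only: intA)

lemma continuous_field_op_perspective:
  assumes g: "continuous_on {m..M} g"
  shows "continuous_field \<A> \<mu> (\<lambda>s. op_perspective g (A s) (B s))"
proof -
  have contA: "continuous_on UNIV A" and contB: "continuous_on UNIV B"
    and intnA: "integrable \<mu> (\<lambda>s. norm (A s))" and memA: "A s \<in> \<A>" and memB: "B s \<in> \<A>" for s
    using A B by (auto simp: continuous_field_def)
  note comp = bounded_bilinear.continuous_on[OF bounded_bilinear_blinfun_compose]
  note between = op_between_op_quotient[OF posA mAB ABM]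
  have powr_mem: "op_powr (A s) q \<in> \<A>" for s q
  proof -
    obtain a b where ab: "0 < a" "op_between a b (A s)"
      using strictly_positive_op_between[OF posA] .
    show ?thesis by (rule op_powr_mem_cstar_algebra[OF alg id_mem memA ab])
  qed
  have quot_mem: "op_quotient (A s) (B s) \<in> \<A>" for s
    unfolding op_quotient_def by (intro cstar_algebraD(6)[OF alg] powr_mem memB)
  have mem: "op_perspective g (A s) (B s) \<in> \<A>" for s
    unfolding op_perspective_def
    by (intro cstar_algebraD(6)[OF alg] powr_mem
        fun_calc_mem_cstar_algebra[OF alg id_mem quot_mem between g])
  have "continuous_on UNIV (\<lambda>s. op_quotient (A s) (B s))"
    unfolding op_quotient_def by (intro comp continuous_on_op_powr[OF contA posA] contB)
  then have cont: "continuous_on UNIV (\<lambda>s. op_perspective g (A s) (B s))"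
    unfolding op_perspective_def
    by (intro comp continuous_on_op_powr[OF contA posA] continuous_on_fun_calc[OF _ between g])
  have "bounded (g ` {m..M})"
    by (rule compact_imp_bounded[OF compact_continuous_image[OF g compact_Icc]])
  then obtain c where c: "0 < c" "\<And>t. t \<in> {m..M} \<Longrightarrow> \<bar>g t\<bar> \<le> c"
    by (auto simp: bounded_pos)
  have i: "integrable \<mu> (\<lambda>s. c * norm (A s))" using intnA by auto
  have me: "(\<lambda>s. norm (op_perspective g (A s) (B s))) \<in> borel_measurable \<mu>"
    by (rule continuous_borel_measurable_radon[OF \<mu> continuous_on_norm[OF cont]])
  have le: "norm (op_perspective g (A s) (B s)) \<le> c * norm (A s)" for s
    by (rule norm_op_perspective_le[OF posA mAB ABM g c(2)]) (use c(1) in auto)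
  have "integrable \<mu> (\<lambda>s. norm (op_perspective g (A s) (B s)))"
  proof (rule Bochner_Integration.integrable_bound[OF i me], rule AE_I2)
    fix s
    show "norm (norm (op_perspective g (A s) (B s))) \<le> norm (c * norm (A s))"
      using le[of s] c(1) by simp
  qed
  with mem cont show ?thesis by (simp add: continuous_field_def)
qed

text \<open>As \<open>g\<close> varies, this is a positive linear map on the continuous functions on \<open>{m..M}\<close>; it sends the
  constant 1 to the integral of \<open>A\<close>, which is the identity, and the identity function to the integral of \<open>B\<close>.\<close>

definition integral_perspective :: "(real \<Rightarrow> real) \<Rightarrow> 'a \<Rightarrow>\<^sub>L 'a" where
  "integral_perspective g = op_integral \<A> \<mu> (\<lambda>s. op_perspective g (A s) (B s))"

lemma self_adjoint_integral_perspective: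
  assumes g: "continuous_on {m..M} g"
  shows "self_adjoint (integral_perspective g)"
  unfolding integral_perspective_def
  by (intro self_adjoint_op_integral[OF \<mu> alg continuous_field_op_perspective[OF g]]
      self_adjoint_op_perspective[OF posA mAB ABM g])

lemma quad_integral_perspective_mono:
  assumes g: "continuous_on {m..M} g" and h: "continuous_on {m..M} h"
    and le: "\<And>t. t \<in> {m..M} \<Longrightarrow> g t \<le> h t"
  shows "quad (integral_perspective g) x \<le> quad (integral_perspective h) x"
  unfolding integral_perspective_def
    quad_op_integral[OF \<mu> alg continuous_field_op_perspective[OF g]]
    quad_op_integral[OF \<mu> alg continuous_field_op_perspective[OF h]]
proof (rule integral_mono)
  fix s
  show "quad (op_perspective g (A s) (B s)) x \<le> quad (op_perspective h (A s) (B s)) x"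
    unfolding quad_op_perspective[OF posA mAB ABM]
    by (rule quad_fun_calc_mono[OF op_between_op_quotient[OF posA mAB ABM] g h le])
qed (rule integrable_quad_field[OF \<mu> alg continuous_field_op_perspective], rule g h)+

lemma quad_integral_perspective_linear:
  assumes g: "continuous_on {m..M} g" and h: "continuous_on {m..M} h"
  shows "quad (integral_perspective (\<lambda>t. c * g t + d * h t)) x
    = c * quad (integral_perspective g) x + d * quad (integral_perspective h) x"
proof -
  have gh: "continuous_on {m..M} (\<lambda>t. c * g t + d * h t)" by (intro continuous_intros g h)
  have "quad (op_perspective (\<lambda>t. c * g t + d * h t) (A s) (B s)) x
      = c * quad (op_perspective g (A s) (B s)) x + d * quad (op_perspective h (A s) (B s)) x" for s
    unfolding quad_op_perspective[OF posA mAB ABM]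
      fun_calc_linear_combination[OF op_between_op_quotient[OF posA mAB ABM] g h]
    by simp
  then show ?thesis
    unfolding integral_perspective_def
      quad_op_integral[OF \<mu> alg continuous_field_op_perspective[OF g]]
      quad_op_integral[OF \<mu> alg continuous_field_op_perspective[OF h]]
      quad_op_integral[OF \<mu> alg continuous_field_op_perspective[OF gh]]
    using integrable_quad_field[OF \<mu> alg continuous_field_op_perspective[OF g], of x]
      integrable_quad_field[OF \<mu> alg continuous_field_op_perspective[OF h], of x]
    by simp
qed

lemma integral_perspective_1: "integral_perspective (\<lambda>_. 1) = id_blinfun"
  unfolding integral_perspective_def op_perspective_1[OF posA mAB ABM] by (rule intA)

lemma integral_perspective_id:
  "integral_perspective (\<lambda>t. t) = op_integral \<A> \<mu> B"
  unfolding integral_perspective_def op_perspective_id[OF posA mAB ABM] ..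

end

section \<open>The reverse Jensen inequality for the relative entropy\<close>

theorem theorem3p2:
  fixes \<mu> :: "'t::t2_space measure"
    and \<A> :: "('a::chilbert_space \<Rightarrow>\<^sub>L 'a) set"
    and A B :: "'t \<Rightarrow> 'a \<Rightarrow>\<^sub>L 'a"
    and f :: "real \<Rightarrow> real" and m M p t0 :: real
  assumes "locally_compact_space (euclidean :: 't topology)"
    and "radon_measure \<mu>"
    and "cstar_algebra \<A>"
    and "continuous_field \<A> \<mu> A" and "continuous_field \<A> \<mu> B"
    and "\<And>s. strictly_positive (A s)" and "\<And>s. strictly_positive (B s)"
    and "0 < m" and "m < 1" and "1 < M"
    and "\<And>s. m *\<^sub>R A s \<preceq> B s" and "\<And>s. B s \<preceq> M *\<^sub>R A s"
    and "op_integral \<A> \<mu> A = id_blinfun" and "op_integral \<A> \<mu> B = id_blinfun"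
    and "\<And>t. 0 < t \<Longrightarrow> 0 \<le> f t"
    and "operator_concave TYPE('a \<times> nat) {0<..} f"
    and "\<exists>t>0. f t \<noteq> 0"
    and "0 \<le> p" and "p \<le> 1" and "m \<le> t0" and "t0 \<le> M"
  shows "fun_calc f
           (op_integral \<A> \<mu> (\<lambda>s. natural_mean (p + 1) (A s) (B s))
             + t0 *\<^sub>R (id_blinfun - op_integral \<A> \<mu> (\<lambda>s. natural_mean p (A s) (B s))))
         - (chord_ratio_max f m M * f t0) *\<^sub>R
             (id_blinfun - op_integral \<A> \<mu> (\<lambda>s. natural_mean p (A s) (B s)))
         \<preceq> chord_ratio_max f m M *\<^sub>R gen_rel_entropy \<A> \<mu> p f A B"
proof -
  have mM: "m < M" using assms by linarith
  have Icc: "{m..M} \<subseteq> {0<..}" using assms(8) by auto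
  have conc: "concave_on {0<..} f"
    by (rule concave_on_if_operator_concave[OF assms(16)]) (rule convex_real_interval)
  then have concI: "concave_on {m..M} f"
    using Icc by (auto simp: concave_on_iff)
  have fc: "continuous_on {m..M} f"
    using assms(16) Icc unfolding operator_concave_def by (blast intro: continuous_on_subset)
  have fpos: "0 < f t" if "t \<in> {m..M}" for t
    using concave_nonneg_pos[OF conc assms(15,17)] Icc that by auto
  define \<gamma> where "\<gamma> = chord_ratio_max f m M"
  define k where "k = chord_slope f m M"
  define l where "l = chord_intercept f m M"
  have \<gamma>: "0 < \<gamma>" "\<And>t. t \<in> {m..M} \<Longrightarrow> f t \<le> \<gamma> * (k * t + l)"
    unfolding \<gamma>_def k_def l_def by (rule chord_ratio_max_bound[OF concI fc fpos mM]; assumption)+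
  have chord: "k * t + l \<le> f t" if "t \<in> {m..M}" for t
    unfolding k_def l_def by (rule chord_between(2)[OF concI fc fpos mM that])
  define J where "J = integral_perspective \<mu> \<A> A B"
  note ctx = assms(2,3,4,5,6,11,12,13)
  note J_mono = quad_integral_perspective_mono[OF ctx, folded J_def]
    and J_linear = quad_integral_perspective_linear[OF ctx, folded J_def]
    and J_sa = self_adjoint_integral_perspective[OF ctx, folded J_def]
  have J1: "J (\<lambda>_. 1) = id_blinfun" unfolding J_def by (rule integral_perspective_1[OF ctx])
  have Jid: "J (\<lambda>t. t) = id_blinfun"
    unfolding J_def integral_perspective_id[OF ctx] by (rule assms(14))
  have pc: "continuous_on {m..M} (\<lambda>t. t powr q)" for q
    by (rule continuous_on_powr_Icc[OF assms(8)])
  have pfc: "continuous_on {m..M} (\<lambda>t. t powr p * f t)" by (intro continuous_intros pc fc)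
  define P where "P = J (\<lambda>t. t powr p)"
  define Q where "Q = J (\<lambda>t. t powr (p + 1))"
  define S where "S = J (\<lambda>t. t powr p * f t)"
  have P: "op_integral \<A> \<mu> (\<lambda>s. natural_mean p (A s) (B s)) = P"
    and Q: "op_integral \<A> \<mu> (\<lambda>s. natural_mean (p + 1) (A s) (B s)) = Q"
    by (simp_all add: P_def Q_def J_def integral_perspective_def[OF ctx] natural_mean_eq_perspective)
  have S: "gen_rel_entropy \<A> \<mu> p f A B = S"
    unfolding gen_rel_entropy_def S_def J_def integral_perspective_def[OF ctx]
      rel_entropy_eq_perspective[OF assms(6,11,12,8) fc] ..
  have saP: "self_adjoint P" and saQ: "self_adjoint Q" and saS: "self_adjoint S"
    unfolding P_def Q_def S_def by (intro J_sa pc pfc)+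
  define Z where "Z = Q + t0 *\<^sub>R (id_blinfun - P)"
  \<comment> \<open>Weighted arithmetic-geometric mean, integrated; both integrals of the fields are the identity.\<close>
  have P_le: "quad P x \<le> (norm x)\<^sup>2" for x
  proof -
    have "quad P x \<le> quad (J (\<lambda>t. p * t + (1 - p) * 1)) x"
      unfolding P_def
    proof (rule J_mono[OF pc])
      fix t assume "t \<in> {m..M}"
      then show "t powr p \<le> p * t + (1 - p) * 1"
        using Youngs_inequality_0[of p "1 - p" t 1] assms(8,18,19) by auto
    qed (intro continuous_intros)
    also have "\<dots> = (norm x)\<^sup>2"
      by (subst J_linear) (auto simp: J1 Jid algebra_simps intro!: continuous_intros)
    finally show ?thesis .
  qed
  \<comment> \<open>The factor \<open>t\<close> in \<open>t powr (p + 1)\<close> lies between \<open>m\<close> and \<open>M\<close>.  The zero term gives the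
    shape of a linear combination.\<close>
  have Q_ge: "m * quad P x \<le> quad Q x" and Q_le: "quad Q x \<le> M * quad P x" for x
  proof -
    have eq: "c * quad P x = quad (J (\<lambda>t. c * t powr p + 0 * t powr p)) x" for c
      by (subst J_linear[OF pc pc]) (simp add: P_def)
    have "m * t powr p \<le> t powr (p + 1)" "t powr (p + 1) \<le> M * t powr p" if "t \<in> {m..M}" for t
      using that assms(8) by (auto simp: powr_add mult.commute intro!: mult_right_mono)
    then show "m * quad P x \<le> quad Q x" "quad Q x \<le> M * quad P x"
      unfolding eq Q_def by (auto intro!: J_mono pc continuous_intros)
  qed
  \<comment> \<open>\<open>Q\<close> lies between \<open>m * P\<close> and \<open>M * P\<close>, and the other term between the same multiples of \<open>I - P\<close>.\<close>
  have Z: "op_between m M Z"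
    unfolding op_between_def
  proof (intro conjI allI)
    show "self_adjoint Z" unfolding Z_def using saP saQ by auto
    fix x
    have qZ: "quad Z x = quad Q x + t0 * ((norm x)\<^sup>2 - quad P x)" by (simp add: Z_def)
    have "0 \<le> (norm x)\<^sup>2 - quad P x" using P_le[of x] by simp
    then have "m * ((norm x)\<^sup>2 - quad P x) \<le> t0 * ((norm x)\<^sup>2 - quad P x)"
      "t0 * ((norm x)\<^sup>2 - quad P x) \<le> M * ((norm x)\<^sup>2 - quad P x)"
      using assms(20,21) by (auto intro: mult_right_mono)
    then show "m * (norm x)\<^sup>2 \<le> quad Z x" "quad Z x \<le> M * (norm x)\<^sup>2"
      using Q_ge[of x] Q_le[of x] unfolding qZ by (auto simp: algebra_simps)
  qed
  have le: "quad (fun_calc f Z) x - \<gamma> * f t0 * ((norm x)\<^sup>2 - quad P x) \<le> \<gamma> * quad S x" for x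
  proof -
    have "quad (fun_calc f Z) x \<le> quad (fun_calc (\<lambda>t. (\<gamma> * k) * t + (\<gamma> * l) * 1) Z) x"
      using \<gamma>(2) by (intro quad_fun_calc_mono[OF Z fc]) (auto intro!: continuous_intros simp: algebra_simps)
    also have "\<dots> = \<gamma> * (k * quad Z x + l * (norm x)\<^sup>2)"
      by (subst fun_calc_linear_combination[OF Z])
         (auto simp: fun_calc_id[OF Z] fun_calc_const[OF Z] algebra_simps intro!: continuous_intros)
    \<comment> \<open>The chord is affine and the weights \<open>P\<close> and \<open>I - P\<close> add up to the identity.\<close>
    also have "k * quad Z x + l * (norm x)\<^sup>2
        = (k * quad Q x + l * quad P x) + (k * t0 + l) * ((norm x)\<^sup>2 - quad P x)"
      by (simp add: Z_def algebra_simps)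
    also have "\<gamma> * \<dots> \<le> \<gamma> * (quad S x + f t0 * ((norm x)\<^sup>2 - quad P x))"
    proof (intro mult_left_mono add_mono mult_right_mono)
      have "k * quad Q x + l * quad P x = quad (J (\<lambda>t. k * t powr (p + 1) + l * t powr p)) x"
        unfolding P_def Q_def by (rule J_linear[OF pc pc, symmetric])
      also have "\<dots> \<le> quad S x"
        unfolding S_def
      proof (rule J_mono)
        fix t assume t: "t \<in> {m..M}"
        then have "k * t powr (p + 1) + l * t powr p = t powr p * (k * t + l)"
          using assms(8) by (simp add: powr_add algebra_simps)
        also have "\<dots> \<le> t powr p * f t" by (intro mult_left_mono chord t) simp
        finally show "k * t powr (p + 1) + l * t powr p \<le> t powr p * f t" .
      qed (intro continuous_intros pc pfc)+
      finally show "k * quad Q x + l * quad P x \<le> quad S x" .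
      show "k * t0 + l \<le> f t0" using assms(20,21) by (intro chord) simp
    qed (use P_le \<gamma>(1) in auto)
    finally show ?thesis by (simp add: algebra_simps)
  qed
  show ?thesis
    unfolding P Q S Z_def[symmetric] \<gamma>_def[symmetric] loewner_le_iff_quad
    using le self_adjoint_fun_calc[OF Z fc] saP saS by auto
qed

end
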